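(* Let $X$ be a super-reflexive Banach space, $E\subset X$, and let $f$ be a real function on $E$. Then the following statements are equivalent: (i) $f$ can be extended to a real function $F\in C^{1,+}_{\mathrm B}(X)$. (ii) $f$ satisfies condition $(\widetilde{\mathrm W})$ on $E$: there exists a mapping $G\colon E\to X^*$ such that for each bounded $B\subset E$ the function $f$ is bounded on $B$, the mapping $G$ is bounded and uniformly continuous on $B$, and for each $\varepsilon>0$ there exists $\delta>0$ such that $|f(y)-f(x)-\langle G(x),y-x\rangle|\le\varepsilon\|y-x\|$ whenever $x,y\in B$ and $\|y-x\|<\delta$. (iii) For each bounded $A\subset E$ the function $f$ is bounded on $A$ and there exists a bounded $G_A\colon A\to X^*$ such that $f|_A$ satisfies condition $(\mathrm W_{G_A})$ (on $A$). Moreover, if $(\widetilde{\mathrm W})$ is satisfied with $G$, then $F$ can be found such that $DF(x)=G(x)$ for each $x\in E$.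
   Context: All normed linear spaces are real; $\langle g,x\rangle=g(x)$ for $g\in X^*$, $x\in X$, and $DF$ denotes the Fréchet derivative of $F$. For an open subset $U$ of a normed linear space, $C^{1,+}_{\mathrm B}(U)$ is the set of all Fréchet differentiable functions $f\colon U\to\mathbb R$ such that $Df$ is uniformly continuous on each bounded subset of $U$. For $A\subset X$, $f\colon A\to\mathbb R$ and $H\colon A\to X^*$, we say that $f$ satisfies condition $(\mathrm W_H)$ (on $A$) if $H$ is uniformly continuous and for each $\varepsilon>0$ there exists $\delta>0$ such that $|f(y)-f(x)-\langle H(x),y-x\rangle|\le\varepsilon\|y-x\|$ whenever $x,y\in A$ and $\|y-x\|<\delta$. A Banach space is super-reflexive if and only if it has an equivalent uniformly smooth norm. *)

theory Defs
  imports "HOL-Analysis.Analysis"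
begin

definition equivalent_norm :: "('a::real_normed_vector \<Rightarrow> real) \<Rightarrow> bool" where
  "equivalent_norm N \<longleftrightarrow>
     (\<forall>x. N x = 0 \<longleftrightarrow> x = 0) \<and>
     (\<forall>c x. N (c *\<^sub>R x) = \<bar>c\<bar> * N x) \<and>
     (\<forall>x y. N (x + y) \<le> N x + N y) \<and>
     (\<exists>a>0. \<exists>b>0. \<forall>x. a * norm x \<le> N x \<and> N x \<le> b * norm x)"

text \<open>With the modulus of smoothness
  \<open>\<rho>(\<tau>) = sup {(N (x + h) + N (x - h)) / 2 - 1 | N x = 1, N h = \<tau>}\<close>,
  the following says that \<open>\<rho>(\<tau>) / \<tau> \<rightarrow> 0\<close> as \<open>\<tau> \<rightarrow> 0+\<close>. It is written without the
  supremum, which would be taken over the empty set when the space is trivial.\<close>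

definition uniformly_smooth :: "('a::real_normed_vector \<Rightarrow> real) \<Rightarrow> bool" where
  "uniformly_smooth N \<longleftrightarrow>
     (\<forall>\<epsilon>>0. \<exists>\<delta>>0. \<forall>x h. N x = 1 \<and> N h \<le> \<delta> \<longrightarrow>
        N (x + h) + N (x - h) \<le> 2 + \<epsilon> * N h)"

text \<open>Super-reflexivity is taken in its renorming form. The definition through finite
  representability quantifies over all Banach spaces, hence over types.\<close>

definition super_reflexive :: "'a::banach itself \<Rightarrow> bool" where
  "super_reflexive (_ :: 'a itself) \<longleftrightarrow>
     (\<exists>N :: 'a \<Rightarrow> real. equivalent_norm N \<and> uniformly_smooth N)"

text \<open>The argument of \<open>Blinfun\<close> is bounded linear, so that this is the Frechet derivative
  as an element of the dual space, only where \<open>f\<close> is differentiable.\<close>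

definition DF :: "('a::real_normed_vector \<Rightarrow> real) \<Rightarrow> 'a \<Rightarrow> ('a \<Rightarrow>\<^sub>L real)" where
  "DF f x = Blinfun (frechet_derivative f (at x))"

text \<open>Functions on a subset of the space are total functions of which only the values on that
  subset matter; here \<open>U\<close> is meant to be open.\<close>

definition C1plusB :: "'a::real_normed_vector set \<Rightarrow> ('a \<Rightarrow> real) set" where
  "C1plusB U = {f. (\<forall>x\<in>U. f differentiable (at x)) \<and>
     (\<forall>B. B \<subseteq> U \<and> bounded B \<longrightarrow> uniformly_continuous_on B (DF f))}"

definition cond_W ::
  "('a::real_normed_vector \<Rightarrow> real) \<Rightarrow> 'a set \<Rightarrow> ('a \<Rightarrow> ('a \<Rightarrow>\<^sub>L real)) \<Rightarrow> bool" where
  "cond_W f A H \<longleftrightarrow> uniformly_continuous_on A H \<and>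
     (\<forall>\<epsilon>>0. \<exists>\<delta>>0. \<forall>x\<in>A. \<forall>y\<in>A. norm (y - x) < \<delta> \<longrightarrow>
        \<bar>f y - f x - blinfun_apply (H x) (y - x)\<bar> \<le> \<epsilon> * norm (y - x))"

definition cond_W_tilde_with ::
  "('a::real_normed_vector \<Rightarrow> real) \<Rightarrow> 'a set \<Rightarrow> ('a \<Rightarrow> ('a \<Rightarrow>\<^sub>L real)) \<Rightarrow> bool" where
  "cond_W_tilde_with f E G \<longleftrightarrow>
     (\<forall>B. B \<subseteq> E \<and> bounded B \<longrightarrow>
        bounded (f ` B) \<and> bounded (G ` B) \<and> uniformly_continuous_on B G \<and>
        (\<forall>\<epsilon>>0. \<exists>\<delta>>0. \<forall>x\<in>B. \<forall>y\<in>B. norm (y - x) < \<delta> \<longrightarrow>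
           \<bar>f y - f x - blinfun_apply (G x) (y - x)\<bar> \<le> \<epsilon> * norm (y - x)))"

definition cond_W_tilde :: "('a::real_normed_vector \<Rightarrow> real) \<Rightarrow> 'a set \<Rightarrow> bool" where
  "cond_W_tilde f E \<longleftrightarrow> (\<exists>G. cond_W_tilde_with f E G)"

end

theory Submission
  imports Defs
begin

text \<open>
  The heart of the matter is the extension of a bounded jet \<open>(f, G)\<close> that satisfies
  \<open>(W\<^sub>G)\<close> on an arbitrary set \<open>E\<close>, by an insertion argument. The remainders
  \<open>f(y) - f(x) - G(x)(y - x)\<close>, relative to \<open>|y - x|\<close>, and the increments of \<open>G\<close> have a common modulus
  \<open>\<beta>\<close> (\<open>cond_W_modulus\<close>). Let \<open>J\<^sub>y(x) = f(y) + G(y)(x - y)\<close>. If \<open>\<phi>(z)\<close> dominates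
  \<open>3 |z| \<beta>(2|z|)\<close>, then \<open>J\<^sub>y(x) - \<phi>(x - y) \<le> J\<^sub>z(x) + \<phi>(x - z)\<close> for all \<open>y, z \<in> E\<close>, so that
  \<open>l(x) = sup\<^sub>y (J\<^sub>y(x) - \<phi>(x - y))\<close> lies below \<open>g(x) = inf\<^sub>y (J\<^sub>y(x) + \<phi>(x - y))\<close>, and every function
  between \<open>l\<close> and \<open>g\<close> has the prescribed values on \<open>E\<close>, and, as \<open>\<phi>(z) = o(|z|)\<close>, the prescribed
  derivatives too. It remains to find a smooth one.

  Super-reflexivity enters only through \<open>\<phi>\<close>: composing an antiderivative of \<open>\<beta>\<close> with a uniformly
  smooth norm gives a gauge \<open>\<phi>\<close> that is semiconcave with a uniform modulus (\<open>smooth_gauge\<close>).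
  Semiconcavity is inherited by infima of translates plus affine functions; hence \<open>g\<close> is semiconcave
  and \<open>l\<close> is semiconvex, with the same modulus.

  The smooth function in between is the largest semiconvex function \<open>F\<close> (with that modulus) below
  \<open>g\<close>. It exists because \<open>l\<close> is one of them and semiconvexity with a given modulus is preserved by
  suprema. It is also semiconcave: the functions \<open>t F(\<cdot> + (1 - t) h) + (1 - t) F(\<cdot> - t h) - c\<close> are again
  semiconvex, as averages of translates, and are below \<open>g\<close> when \<open>c\<close> is the semiconcavity bound of \<open>g\<close>;
  hence they are below \<open>F\<close>, which is the semiconcavity of \<open>F\<close> (\<open>jensen_insertion\<close>). In any normed
  space, a locally bounded function that is both semiconvex and semiconcave has a uniformly continuous derivative
  (\<open>taylor_of_semiconcave\<close> and the lemmas after it).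

  The passage from bounded pieces to all of \<open>E\<close> is a gluing by smooth bumps, which are themselves
  extensions of jets: the indicator function of a ball, with zero derivative, satisfies the condition
  on the union of the ball and the complement of a larger ball. Gluing needs only the extendability
  of \<open>f\<close> on bounded pieces, so that the mappings \<open>G\<^sub>A\<close> of the third condition need not agree. If they
  do come from one mapping \<open>G\<close>, the bumps do not disturb the derivatives: at a point of \<open>E\<close>
  where two extensions disagree, the bump that blends them vanishes together with its derivative.
\<close>

section \<open>Insertion between a semiconvex and a semiconcave function\<close>

text \<open>
  The point \<open>z\<close> is the convex combination of two points that differ by \<open>h\<close>. Parametrising by \<open>z\<close> and
  \<open>h\<close> instead of by these points makes the gap a combination of translates, which is what the
  insertion argument uses.
\<close>

definition jensen_gap :: "('a::real_vector \<Rightarrow> real) \<Rightarrow> real \<Rightarrow> 'a \<Rightarrow> 'a \<Rightarrow> real" where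
  "jensen_gap F t h z = t * F (z + (1 - t) *\<^sub>R h) + (1 - t) * F (z - t *\<^sub>R h) - F z"

text \<open>
  This is semiconcavity with some modulus \<open>\<omega>\<close>, \<open>\<omega>(0+) = 0\<close>, where the gap is at most
  \<open>t (1 - t) \<omega>(|h|) |h|\<close>; only the behaviour for small \<open>h\<close> matters for differentiability.
\<close>

definition uniformly_semiconcave :: "('a::real_normed_vector \<Rightarrow> real) \<Rightarrow> bool" where
  "uniformly_semiconcave F \<longleftrightarrow>
     (\<forall>\<epsilon>>0. \<exists>\<delta>>0. \<forall>t h z. 0 \<le> t \<and> t \<le> 1 \<and> norm h \<le> \<delta> \<longrightarrow>
        jensen_gap F t h z \<le> \<epsilon> * (t * (1 - t) * norm h))"

lemma uniformly_semiconcaveD: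
  assumes "uniformly_semiconcave F" "\<epsilon> > 0"
  shows "\<exists>\<delta>>0. \<forall>t h z. 0 \<le> t \<and> t \<le> 1 \<and> norm h \<le> \<delta> \<longrightarrow>
    jensen_gap F t h z \<le> \<epsilon> * (t * (1 - t) * norm h)"
  using assms by (simp add: uniformly_semiconcave_def)

text \<open>
  An insertion theorem of Ilmanen type. The function \<open>F\<close> is the largest one below \<open>g\<close> that satisfies
  every lower bound \<open>- c \<le> jensen_gap F t h\<close> for which \<open>g\<close> and \<open>l\<close> satisfy the two
  hypotheses of the conclusion. For the upper bounds, averaging translates of \<open>F\<close> and subtracting
  \<open>c\<close> gives a competitor in the definition of \<open>F\<close>. No modulus is mentioned, because the bounds
  for different \<open>t\<close>, \<open>h\<close> and \<open>c\<close> are transferred independently, by one and the same \<open>F\<close>.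
\<close>

lemma jensen_insertion:
  fixes l g :: "'a::real_vector \<Rightarrow> real"
  assumes lg: "\<And>z. l z \<le> g z"
  obtains F where "\<And>z. l z \<le> F z" "\<And>z. F z \<le> g z"
    "\<forall>t\<in>{0..1}. \<forall>h c. (\<forall>z. jensen_gap g t h z \<le> c) \<and> (\<forall>z. - c \<le> jensen_gap l t h z) \<longrightarrow>
      (\<forall>z. \<bar>jensen_gap F t h z\<bar> \<le> c)"
proof -
  define K where "K t h c \<longleftrightarrow> 0 \<le> t \<and> t \<le> 1 \<and> (\<forall>z. jensen_gap g t h z \<le> c) \<and> (\<forall>z. - c \<le> jensen_gap l t h z)"
    for t h c
  define S where "S = {s. (\<forall>z. s z \<le> g z) \<and> (\<forall>t h c. K t h c \<longrightarrow> (\<forall>z. - c \<le> jensen_gap s t h z))}"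
  define F where "F z = (SUP s\<in>S. s z)" for z
  have "l \<in> S"
    using lg by (auto simp: S_def K_def)
  have bdd: "bdd_above ((\<lambda>s. s z) ` S)" for z
    by (rule bdd_aboveI2[where M = "g z"]) (auto simp: S_def)
  have S_le_F: "s z \<le> F z" if "s \<in> S" for s z
    unfolding F_def by (rule cSUP_upper[OF that bdd])
  have F_least: "F z \<le> b" if "\<And>s. s \<in> S \<Longrightarrow> s z \<le> b" for z b
    unfolding F_def using \<open>l \<in> S\<close> by (intro cSUP_least that) auto
  have F_le_g: "F z \<le> g z" for z
    by (rule F_least) (auto simp: S_def)
  have lower: "- c \<le> jensen_gap F t h z" if K: "K t h c" for t h c z
  proof -
    have "F z \<le> t * F (z + (1 - t) *\<^sub>R h) + (1 - t) * F (z - t *\<^sub>R h) + c"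
    proof (rule F_least)
      fix s assume s: "s \<in> S"
      then have "- c \<le> jensen_gap s t h z"
        using K by (auto simp: S_def)
      moreover have "t * s (z + (1 - t) *\<^sub>R h) \<le> t * F (z + (1 - t) *\<^sub>R h)"
        "(1 - t) * s (z - t *\<^sub>R h) \<le> (1 - t) * F (z - t *\<^sub>R h)"
        using K by (auto simp: K_def intro!: mult_left_mono S_le_F[OF s])
      ultimately show "s z \<le> t * F (z + (1 - t) *\<^sub>R h) + (1 - t) * F (z - t *\<^sub>R h) + c"
        by (simp add: jensen_gap_def)
    qed
    then show ?thesis
      by (simp add: jensen_gap_def)
  qed
  have upper: "jensen_gap F t h z \<le> c" if K: "K t h c" for t h c z
  proof -
    \<comment> \<open>The competitor: its Jensen gaps are averages of those of F.\<close>
    define s where "s = (\<lambda>z. t * F (z + (1 - t) *\<^sub>R h) + (1 - t) * F (z - t *\<^sub>R h) - c)"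
    have lam: "0 \<le> t" "t \<le> 1"
      using K by (auto simp: K_def)
    have "s \<in> S"
      unfolding S_def mem_Collect_eq
    proof (intro conjI allI impI)
      fix w
      have "jensen_gap g t h w \<le> c"
        using K by (auto simp: K_def)
      moreover have "t * F (w + (1 - t) *\<^sub>R h) \<le> t * g (w + (1 - t) *\<^sub>R h)"
        "(1 - t) * F (w - t *\<^sub>R h) \<le> (1 - t) * g (w - t *\<^sub>R h)"
        using lam by (auto intro!: mult_left_mono F_le_g)
      ultimately show "s w \<le> g w"
        by (simp add: jensen_gap_def s_def)
    next
      fix \<mu> k e w assume K': "K \<mu> k e"
      have "jensen_gap s \<mu> k w = t * jensen_gap F \<mu> k (w + (1 - t) *\<^sub>R h) + (1 - t) * jensen_gap F \<mu> k (w - t *\<^sub>R h)"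
        by (simp add: jensen_gap_def s_def algebra_simps)
      also have "\<dots> \<ge> t * (- e) + (1 - t) * (- e)"
        using lam by (intro add_mono mult_left_mono lower[OF K']) auto
      finally show "- e \<le> jensen_gap s \<mu> k w"
        by (simp add: algebra_simps)
    qed
    from S_le_F[OF this, of z] show ?thesis
      by (simp add: s_def jensen_gap_def)
  qed
  show thesis
  proof (rule that)
    show "l z \<le> F z" for z
      by (rule S_le_F) fact
    show "F z \<le> g z" for z
      by (rule F_le_g)
    show "\<forall>t\<in>{0..1}. \<forall>h c. (\<forall>z. jensen_gap g t h z \<le> c) \<and> (\<forall>z. - c \<le> jensen_gap l t h z) \<longrightarrow>
      (\<forall>z. \<bar>jensen_gap F t h z\<bar> \<le> c)"
    proof (intro ballI allI impI)
      fix t h c z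
      assume "t \<in> {0..1}" "(\<forall>z. jensen_gap g t h z \<le> c) \<and> (\<forall>z. - c \<le> jensen_gap l t h z)"
      then have "K t h c"
        by (auto simp: K_def)
      from lower[OF this, of z] upper[OF this, of z] show "\<bar>jensen_gap F t h z\<bar> \<le> c"
        by (auto simp: abs_le_iff)
    qed
  qed
qed

lemma jensen_gap_INF_le:
  fixes p :: "'i \<Rightarrow> 'a::real_vector \<Rightarrow> real"
  assumes "I \<noteq> {}" and bdd: "\<And>x. bdd_below ((\<lambda>i. p i x) ` I)"
    and gap: "\<And>i z. i \<in> I \<Longrightarrow> jensen_gap (p i) t h z \<le> c" and t: "0 \<le> t" "t \<le> 1"
  shows "jensen_gap (\<lambda>x. INF i\<in>I. p i x) t h z \<le> c"
proof -
  define g where "g x = (INF i\<in>I. p i x)" for x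
  have le: "g x \<le> p i x" if "i \<in> I" for i x
    unfolding g_def by (rule cINF_lower[OF bdd that])
  have "t * g (z + (1 - t) *\<^sub>R h) + (1 - t) * g (z - t *\<^sub>R h) - c \<le> g z"
    unfolding g_def[of z]
  proof (rule cINF_greatest[OF \<open>I \<noteq> {}\<close>])
    fix i assume "i \<in> I"
    then have "t * g (z + (1 - t) *\<^sub>R h) \<le> t * p i (z + (1 - t) *\<^sub>R h)"
      "(1 - t) * g (z - t *\<^sub>R h) \<le> (1 - t) * p i (z - t *\<^sub>R h)"
      using t by (auto intro!: mult_left_mono le)
    with gap[OF \<open>i \<in> I\<close>, of z]
    show "t * g (z + (1 - t) *\<^sub>R h) + (1 - t) * g (z - t *\<^sub>R h) - c \<le> p i z"
      by (simp add: jensen_gap_def)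
  qed
  then show ?thesis
    by (simp add: jensen_gap_def g_def)
qed

section \<open>Differentiability of semiconvex and semiconcave functions\<close>

definition uniform_taylor :: "('a::real_normed_vector \<Rightarrow> real) \<Rightarrow> ('a \<Rightarrow> ('a \<Rightarrow>\<^sub>L real)) \<Rightarrow> bool" where
  "uniform_taylor F D \<longleftrightarrow>
     (\<forall>\<epsilon>>0. \<exists>\<delta>>0. \<forall>x h. norm h \<le> \<delta> \<longrightarrow> \<bar>F (x + h) - F x - D x h\<bar> \<le> \<epsilon> * norm h)"

text \<open>
  Two-sided bounds on the Jensen gap say that \<open>F\<close> is affine up to \<open>o(|h|)\<close>, uniformly. With one
  endpoint fixed, they make the dyadic difference quotients uniformly Cauchy; their limit is affine
  and vanishes at \<open>0\<close>, hence linear. Local boundedness is needed for the continuity of this linear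
  functional, since a discontinuous linear \<open>F\<close> has no Jensen gap at all.
\<close>

lemma taylor_of_semiconcave:
  fixes F :: "'a::real_normed_vector \<Rightarrow> real"
  assumes "uniformly_semiconcave F" "uniformly_semiconcave (\<lambda>x. - F x)"
    and bdd: "\<And>x. \<exists>C. \<forall>h. norm h \<le> 1 \<longrightarrow> \<bar>F (x + h)\<bar> \<le> C"
  obtains D :: "'a \<Rightarrow> ('a \<Rightarrow>\<^sub>L real)" where "uniform_taylor F D"
proof -
  have gap: "\<exists>\<delta>>0. \<forall>t h z. 0 \<le> t \<and> t \<le> 1 \<and> norm h \<le> \<delta> \<longrightarrow>
      \<bar>jensen_gap F t h z\<bar> \<le> \<epsilon> * (t * (1 - t) * norm h)" if "\<epsilon> > 0" for \<epsilon>
  proof -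
    obtain \<delta>\<^sub>1 where "\<delta>\<^sub>1 > 0" and \<delta>\<^sub>1: "\<And>t h z. 0 \<le> t \<Longrightarrow> t \<le> 1 \<Longrightarrow> norm h \<le> \<delta>\<^sub>1 \<Longrightarrow>
        jensen_gap F t h z \<le> \<epsilon> * (t * (1 - t) * norm h)"
      using uniformly_semiconcaveD[OF assms(1) \<open>\<epsilon> > 0\<close>] by auto
    obtain \<delta>\<^sub>2 where "\<delta>\<^sub>2 > 0" and \<delta>\<^sub>2: "\<And>t h z. 0 \<le> t \<Longrightarrow> t \<le> 1 \<Longrightarrow> norm h \<le> \<delta>\<^sub>2 \<Longrightarrow>
        jensen_gap (\<lambda>x. - F x) t h z \<le> \<epsilon> * (t * (1 - t) * norm h)"
      using uniformly_semiconcaveD[OF assms(2) \<open>\<epsilon> > 0\<close>] by auto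
    have "jensen_gap (\<lambda>x. - F x) t h z = - jensen_gap F t h z" for t h z
      by (simp add: jensen_gap_def)
    with \<delta>\<^sub>1 \<delta>\<^sub>2 have "\<bar>jensen_gap F t h z\<bar> \<le> \<epsilon> * (t * (1 - t) * norm h)"
      if "0 \<le> t" "t \<le> 1" "norm h \<le> min \<delta>\<^sub>1 \<delta>\<^sub>2" for t h z
      using that by (simp add: abs_le_iff minus_le_iff)
    with \<open>\<delta>\<^sub>1 > 0\<close> \<open>\<delta>\<^sub>2 > 0\<close> show ?thesis
      by (intro exI[of _ "min \<delta>\<^sub>1 \<delta>\<^sub>2"]) auto
  qed
  have combine: "\<exists>\<delta>>0. \<forall>t k k' x. 0 \<le> t \<and> t \<le> 1 \<and> norm (k - k') \<le> \<delta> \<longrightarrow>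
      \<bar>t * (F (x + k) - F x) + (1 - t) * (F (x + k') - F x)
        - (F (x + (t *\<^sub>R k + (1 - t) *\<^sub>R k')) - F x)\<bar> \<le> \<epsilon> * t * norm (k - k')"
    if "\<epsilon> > 0" for \<epsilon>
  proof -
    obtain \<delta> where "\<delta> > 0" and \<delta>: "\<And>t h z. 0 \<le> t \<Longrightarrow> t \<le> 1 \<Longrightarrow> norm h \<le> \<delta> \<Longrightarrow>
        \<bar>jensen_gap F t h z\<bar> \<le> \<epsilon> * (t * (1 - t) * norm h)"
      using gap[OF \<open>\<epsilon> > 0\<close>] by auto
    have "\<bar>t * (F (x + k) - F x) + (1 - t) * (F (x + k') - F x)
        - (F (x + (t *\<^sub>R k + (1 - t) *\<^sub>R k')) - F x)\<bar> \<le> \<epsilon> * t * norm (k - k')"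
      if t: "0 \<le> t" "t \<le> 1" "norm (k - k') \<le> \<delta>" for t k k' x
    proof -
      define z where "z = x + (t *\<^sub>R k + (1 - t) *\<^sub>R k')"
      have "z + (1 - t) *\<^sub>R (k - k') = x + k" "z - t *\<^sub>R (k - k') = x + k'"
        by (simp_all add: z_def algebra_simps)
      then have "t * (F (x + k) - F x) + (1 - t) * (F (x + k') - F x) - (F z - F x)
          = jensen_gap F t (k - k') z"
        by (simp add: jensen_gap_def algebra_simps)
      also have "\<bar>\<dots>\<bar> \<le> \<epsilon> * (t * (1 - t) * norm (k - k'))"
        by (rule \<delta>) (use t in auto)
      also have "\<dots> \<le> \<epsilon> * (t * 1 * norm (k - k'))"
        using t \<open>\<epsilon> > 0\<close> by (intro mult_left_mono mult_right_mono) auto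
      finally show ?thesis
        by (simp add: z_def)
    qed
    with \<open>\<delta> > 0\<close> show ?thesis
      by blast
  qed
  \<comment> \<open>Dyadic steps suffice: the Cauchy estimate compares every step with all smaller ones.\<close>
  define q where "q x h n = 2 ^ n * (F (x + (1 / 2 ^ n) *\<^sub>R h) - F x)" for x h and n :: nat
  have near: "\<exists>\<delta>>0. \<forall>x h n m. n \<le> m \<and> norm h \<le> \<delta> * 2 ^ n \<longrightarrow>
      \<bar>q x h n - q x h m\<bar> \<le> \<epsilon> * norm h" if "\<epsilon> > 0" for \<epsilon>
  proof -
    obtain \<delta> where "\<delta> > 0" and \<delta>: "\<And>t k k' x. 0 \<le> t \<Longrightarrow> t \<le> 1 \<Longrightarrow> norm (k - k') \<le> \<delta> \<Longrightarrow>
      \<bar>t * (F (x + k) - F x) + (1 - t) * (F (x + k') - F x)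
        - (F (x + (t *\<^sub>R k + (1 - t) *\<^sub>R k')) - F x)\<bar> \<le> \<epsilon> * t * norm (k - k')"
      using combine[OF \<open>\<epsilon> > 0\<close>] by auto
    have "\<bar>q x h n - q x h m\<bar> \<le> \<epsilon> * norm h" if "n \<le> m" "norm h \<le> \<delta> * 2 ^ n" for x h n m
    proof -
      define t :: real where "t = 2 ^ n / 2 ^ m"
      define k where "k = (1 / 2 ^ n) *\<^sub>R h"
      have t: "0 \<le> t" "t \<le> 1" "t *\<^sub>R k = (1 / 2 ^ m) *\<^sub>R h" "2 ^ m * t = 2 ^ n"
        using \<open>n \<le> m\<close> by (auto simp: t_def k_def)
      have "norm (k - 0) \<le> \<delta>"
        using that(2) by (simp add: k_def field_simps)
      from \<delta>[OF t(1,2) this, of x]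
      have "\<bar>t * (F (x + k) - F x) - (F (x + t *\<^sub>R k) - F x)\<bar> \<le> \<epsilon> * t * norm k"
        by simp
      then have "2 ^ m * \<bar>t * (F (x + k) - F x) - (F (x + t *\<^sub>R k) - F x)\<bar>
          \<le> 2 ^ m * (\<epsilon> * t * norm k)"
        by (intro mult_left_mono) auto
      moreover have "2 ^ m * \<bar>t * (F (x + k) - F x) - (F (x + t *\<^sub>R k) - F x)\<bar>
          = \<bar>2 ^ m * (t * (F (x + k) - F x) - (F (x + t *\<^sub>R k) - F x))\<bar>"
        by (simp add: abs_mult)
      moreover have "2 ^ m * (t * (F (x + k) - F x) - (F (x + t *\<^sub>R k) - F x)) = q x h n - q x h m"
      proof -
        have "q x h n = (2 ^ m * t) * (F (x + k) - F x)"
          by (simp only: t(4)) (simp add: q_def k_def)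
        moreover have "q x h m = 2 ^ m * (F (x + t *\<^sub>R k) - F x)"
          by (simp only: t(3) q_def)
        ultimately show ?thesis
          by (simp add: algebra_simps)
      qed
      moreover have "2 ^ m * (\<epsilon> * t * norm k) = \<epsilon> * norm h"
        by (simp add: k_def t_def)
      ultimately show ?thesis
        by simp
    qed
    with \<open>\<delta> > 0\<close> show ?thesis
      by blast
  qed
  have "convergent (q x h)" for x h
  proof (rule Cauchy_convergent, rule metric_CauchyI)
    fix e :: real assume "e > 0"
    define \<epsilon> where "\<epsilon> = e / (4 * (norm h + 1))"
    have "\<epsilon> > 0"
      using \<open>e > 0\<close> by (auto simp: \<epsilon>_def intro!: divide_pos_pos add_nonneg_pos)
    from near[OF this] obtain \<delta> where "\<delta> > 0"
      and \<delta>: "\<And>n m. n \<le> m \<Longrightarrow> norm h \<le> \<delta> * 2 ^ n \<Longrightarrow> \<bar>q x h n - q x h m\<bar> \<le> \<epsilon> * norm h"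
      by auto
    obtain M where "norm h / \<delta> < 2 ^ M"
      using real_arch_pow[of 2] by auto
    then have M: "norm h \<le> \<delta> * 2 ^ M"
      using \<open>\<delta> > 0\<close> by (simp add: field_simps)
    have "\<epsilon> * norm h \<le> \<epsilon> * (norm h + 1)"
      using \<open>\<epsilon> > 0\<close> by simp
    also have "\<dots> = e / 4"
    proof -
      have "norm h + 1 > 0"
        using norm_ge_zero[of h] by linarith
      then show ?thesis
        by (simp add: \<epsilon>_def field_simps)
    qed
    finally have "\<epsilon> * norm h \<le> e / 4" .
    then have "dist (q x h m) (q x h n) < e" if "M \<le> m" "M \<le> n" for m n
      using \<delta>[OF that(1) M] \<delta>[OF that(2) M] \<open>e > 0\<close> by (simp add: dist_real_def)
    then show "\<exists>M. \<forall>m\<ge>M. \<forall>n\<ge>M. dist (q x h m) (q x h n) < e"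
      by blast
  qed
  then obtain d where d: "q x h \<longlonglongrightarrow> d x h" for x h
    unfolding convergent_def by metis
  have taylor: "\<exists>\<delta>>0. \<forall>x h. norm h \<le> \<delta> \<longrightarrow> \<bar>F (x + h) - F x - d x h\<bar> \<le> \<epsilon> * norm h"
    if "\<epsilon> > 0" for \<epsilon>
  proof -
    obtain \<delta> where "\<delta> > 0" and \<delta>: "\<And>x h n m. n \<le> m \<Longrightarrow> norm h \<le> \<delta> * 2 ^ n \<Longrightarrow>
        \<bar>q x h n - q x h m\<bar> \<le> \<epsilon> * norm h"
      using near[OF \<open>\<epsilon> > 0\<close>] by auto
    have "\<bar>F (x + h) - F x - d x h\<bar> \<le> \<epsilon> * norm h" if "norm h \<le> \<delta>" for x h
    proof (rule LIMSEQ_le_const2)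
      show "(\<lambda>m. \<bar>F (x + h) - F x - q x h m\<bar>) \<longlonglongrightarrow> \<bar>F (x + h) - F x - d x h\<bar>"
        by (intro tendsto_intros d)
      show "\<exists>N. \<forall>m\<ge>N. \<bar>F (x + h) - F x - q x h m\<bar> \<le> \<epsilon> * norm h"
        using \<delta>[of 0 _ h x] that by (auto simp: q_def)
    qed
    with \<open>\<delta> > 0\<close> show ?thesis
      by blast
  qed
  have affine: "d x (t *\<^sub>R a + (1 - t) *\<^sub>R b) = t * d x a + (1 - t) * d x b"
    if t: "0 \<le> t" "t \<le> 1" for x t a b
  proof -
    define u where
      "u = (\<lambda>n. t * q x a n + (1 - t) * q x b n - q x (t *\<^sub>R a + (1 - t) *\<^sub>R b) n)"
    have "u \<longlonglongrightarrow> t * d x a + (1 - t) * d x b - d x (t *\<^sub>R a + (1 - t) *\<^sub>R b)"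
      unfolding u_def by (intro tendsto_intros d)
    moreover have "u \<longlonglongrightarrow> 0"
    proof (rule LIMSEQ_I)
      fix e :: real assume "e > 0"
      define \<epsilon> where "\<epsilon> = e / (norm (a - b) + 1)"
      have pos: "norm (a - b) + 1 > 0"
        using norm_ge_zero[of "a - b"] by linarith
      have "\<epsilon> > 0"
        using \<open>e > 0\<close> pos by (simp add: \<epsilon>_def)
      from combine[OF this] obtain \<delta> where "\<delta> > 0" and \<delta>: "\<And>t k k' x. 0 \<le> t \<Longrightarrow> t \<le> 1 \<Longrightarrow> norm (k - k') \<le> \<delta> \<Longrightarrow>
      \<bar>t * (F (x + k) - F x) + (1 - t) * (F (x + k') - F x)
        - (F (x + (t *\<^sub>R k + (1 - t) *\<^sub>R k')) - F x)\<bar> \<le> \<epsilon> * t * norm (k - k')"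
        by auto
      obtain M where M: "norm (a - b) / \<delta> < 2 ^ M"
        using real_arch_pow[of 2] by auto
      have "norm (u n - 0) < e" if "n \<ge> M" for n
      proof -
        define k where "k = (1 / 2 ^ n) *\<^sub>R a"
        define k' where "k' = (1 / 2 ^ n) *\<^sub>R b"
        have kk: "norm (k - k') = norm (a - b) / 2 ^ n"
          by (simp add: k_def k'_def flip: scaleR_right_diff_distrib)
        have "(2::real) ^ M \<le> 2 ^ n"
          using that by simp
        with M have "norm (a - b) / \<delta> \<le> 2 ^ n"
          by linarith
        then have "norm (k - k') \<le> \<delta>"
          using \<open>\<delta> > 0\<close> by (simp add: kk field_simps)
        from \<delta>[OF t this, of x]
        have "2 ^ n * \<bar>t * (F (x + k) - F x) + (1 - t) * (F (x + k') - F x)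
          - (F (x + (t *\<^sub>R k + (1 - t) *\<^sub>R k')) - F x)\<bar> \<le> 2 ^ n * (\<epsilon> * t * norm (k - k'))"
          by (intro mult_left_mono) auto
        also have "2 ^ n * (\<epsilon> * t * norm (k - k')) = \<epsilon> * t * norm (a - b)"
          by (simp add: kk)
        also have "\<dots> \<le> \<epsilon> * 1 * norm (a - b)"
          using t \<open>\<epsilon> > 0\<close> by (intro mult_right_mono mult_left_mono) auto
        also have "\<dots> < \<epsilon> * 1 * (norm (a - b) + 1)"
          using \<open>\<epsilon> > 0\<close> by simp
        also have "\<dots> = e"
          using pos by (simp add: \<epsilon>_def)
        also have "2 ^ n * \<bar>t * (F (x + k) - F x) + (1 - t) * (F (x + k') - F x)
          - (F (x + (t *\<^sub>R k + (1 - t) *\<^sub>R k')) - F x)\<bar>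
          = \<bar>2 ^ n * (t * (F (x + k) - F x) + (1 - t) * (F (x + k') - F x)
          - (F (x + (t *\<^sub>R k + (1 - t) *\<^sub>R k')) - F x))\<bar>"
          by (simp add: abs_mult)
        also have "2 ^ n * (t * (F (x + k) - F x) + (1 - t) * (F (x + k') - F x)
          - (F (x + (t *\<^sub>R k + (1 - t) *\<^sub>R k')) - F x)) = u n"
        proof -
          have "(1 / 2 ^ n) *\<^sub>R (t *\<^sub>R a + (1 - t) *\<^sub>R b) = t *\<^sub>R k + (1 - t) *\<^sub>R k'"
            by (simp add: k_def k'_def scaleR_right_distrib)
          then show ?thesis
            unfolding u_def q_def k_def[symmetric] k'_def[symmetric]
            by (simp only:) (simp add: algebra_simps)
        qed
        finally show ?thesis
          by simp
      qed
      then show "\<exists>M. \<forall>n\<ge>M. norm (u n - 0) < e"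
        by blast
    qed
    ultimately show ?thesis
      using LIMSEQ_unique by fastforce
  qed
  have zero: "d x 0 = 0" for x
  proof -
    have "q x 0 = (\<lambda>n. 0)"
      by (auto simp: q_def)
    then show ?thesis
      using d[of x 0] LIMSEQ_unique tendsto_const by metis
  qed
  have shrink: "d x (t *\<^sub>R a) = t * d x a" if "0 \<le> t" "t \<le> 1" for x t a
    using affine[OF that, of x a 0] by (simp add: zero)
  have scale: "d x (c *\<^sub>R a) = c * d x a" if "0 \<le> c" for x c a
  proof (cases "c \<le> 1")
    case False
    then have "d x ((1 / c) *\<^sub>R (c *\<^sub>R a)) = (1 / c) * d x (c *\<^sub>R a)"
      by (intro shrink) auto
    with False show ?thesis
      by (simp add: field_simps)
  qed (use that shrink in auto)
  have add: "d x (a + b) = d x a + d x b" for x a b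
    using affine[of "1/2" x "2 *\<^sub>R a" "2 *\<^sub>R b"] by (simp add: scale)
  have scale': "d x (c *\<^sub>R a) = c * d x a" for x c a
  proof (cases "0 \<le> c")
    case False
    have "d x (c *\<^sub>R a) + d x ((- c) *\<^sub>R a) = 0"
      using add[of x "c *\<^sub>R a" "(- c) *\<^sub>R a"] by (simp add: zero)
    with False scale[of "- c" x a] show ?thesis
      by simp
  qed (rule scale)
  have "bounded_linear (d x)" for x
  proof -
    obtain C where C: "\<And>h. norm h \<le> 1 \<Longrightarrow> \<bar>F (x + h)\<bar> \<le> C"
      using bdd by meson
    obtain \<delta>' where "\<delta>' > 0"
      and \<delta>': "\<And>h. norm h \<le> \<delta>' \<Longrightarrow> \<bar>F (x + h) - F x - d x h\<bar> \<le> 1 * norm h"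
      using taylor[of 1] by auto
    define \<delta> where "\<delta> = min \<delta>' 1"
    have \<delta>: "\<delta> > 0" "\<delta> \<le> \<delta>'" "\<delta> \<le> 1"
      using \<open>\<delta>' > 0\<close> by (auto simp: \<delta>_def)
    show ?thesis
    proof (rule bounded_linear_intro[where K = "(2 * C + 1) / \<delta>"])
      fix h
      show "norm (d x h) \<le> norm h * ((2 * C + 1) / \<delta>)"
      proof (cases "h = 0")
        case False
        define k where "k = (\<delta> / norm h) *\<^sub>R h"
        have k: "norm k = \<delta>"
          using False \<delta> by (simp add: k_def)
        have "\<bar>d x k\<bar> \<le> 2 * C + 1"
          using C[of k] C[of 0] \<delta>'[of k] k \<delta> by auto
        moreover have "d x h = (norm h / \<delta>) * d x k"
          using False \<delta> by (simp add: k_def scale')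
        ultimately show ?thesis
          using \<delta> by (simp add: abs_mult divide_right_mono mult_left_mono)
      qed (simp add: zero)
    qed (simp_all add: add scale')
  qed
  then have "blinfun_apply (Blinfun (d x)) = d x" for x
    by (simp add: bounded_linear_Blinfun_apply)
  with taylor show thesis
    by (intro that[of "\<lambda>x. Blinfun (d x)"]) (simp add: uniform_taylor_def)
qed

lemma has_derivative_of_taylor:
  fixes F :: "'a::real_normed_vector \<Rightarrow> real" and D :: "'a \<Rightarrow> ('a \<Rightarrow>\<^sub>L real)"
  assumes "uniform_taylor F D"
  shows "(F has_derivative D x) (at x)"
  unfolding has_derivative_at_alt
proof (intro conjI allI impI)
  show "bounded_linear (D x)"
    by (rule blinfun.bounded_linear_right)
  fix \<epsilon> :: real assume "\<epsilon> > 0"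
  then obtain \<delta> where "\<delta> > 0"
    and \<delta>: "\<And>h. norm h \<le> \<delta> \<Longrightarrow> \<bar>F (x + h) - F x - D x h\<bar> \<le> \<epsilon> * norm h"
    using assms unfolding uniform_taylor_def by meson
  have "norm (F y - F x - D x (y - x)) \<le> \<epsilon> * norm (y - x)" if "norm (y - x) < \<delta>" for y
    using \<delta>[of "y - x"] that by simp
  with \<open>\<delta> > 0\<close> show "\<exists>\<delta>>0. \<forall>y. norm (y - x) < \<delta> \<longrightarrow>
      norm (F y - F x - D x (y - x)) \<le> \<epsilon> * norm (y - x)"
    by blast
qed

text \<open>
  With \<open>r = |y - x|\<close> and \<open>|k| = r\<close>, the value \<open>F (y + k)\<close> is predicted from \<open>x\<close> directly and from
  \<open>x\<close> via \<open>y\<close>. The two predictions differ by \<open>(D y - D x) k\<close>, and by at most \<open>4 \<epsilon> r\<close>.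
\<close>

lemma uniformly_continuous_of_taylor:
  fixes F :: "'a::real_normed_vector \<Rightarrow> real" and D :: "'a \<Rightarrow> ('a \<Rightarrow>\<^sub>L real)"
  assumes "uniform_taylor F D"
  shows "uniformly_continuous_on UNIV D"
  unfolding uniformly_continuous_on_def
proof (intro allI impI)
  fix e :: real assume "e > 0"
  define \<epsilon> where "\<epsilon> = e / 5"
  have "\<epsilon> > 0"
    using \<open>e > 0\<close> by (simp add: \<epsilon>_def)
  then obtain \<delta> where "\<delta> > 0"
    and \<delta>: "\<And>x h. norm h \<le> \<delta> \<Longrightarrow> \<bar>F (x + h) - F x - D x h\<bar> \<le> \<epsilon> * norm h"
    using assms unfolding uniform_taylor_def by meson
  have "dist (D y) (D x) < e" if "dist y x < \<delta> / 2" for x y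
  proof (cases "y = x")
    case False
    define r where "r = norm (y - x)"
    have r: "0 < r" "2 * r \<le> \<delta>"
      using False that by (auto simp: r_def dist_norm)
    have main: "\<bar>(D y - D x) k\<bar> \<le> 4 * \<epsilon> * r" if k: "norm k = r" for k
    proof -
      have "norm ((y - x) + k) \<le> 2 * r"
        using norm_triangle_ineq[of "y - x" k] k by (simp add: r_def)
      then have "\<bar>F (x + ((y - x) + k)) - F x - D x ((y - x) + k)\<bar> \<le> \<epsilon> * norm ((y - x) + k)"
        and "\<epsilon> * norm ((y - x) + k) \<le> \<epsilon> * (2 * r)"
        using r \<open>\<epsilon> > 0\<close> by (intro \<delta> mult_left_mono; linarith)+
      moreover have "\<bar>F (y + k) - F y - D y k\<bar> \<le> \<epsilon> * r"
        using \<delta>[of k y] r k by simp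
      moreover have "\<bar>F (x + (y - x)) - F x - D x (y - x)\<bar> \<le> \<epsilon> * r"
        using \<delta>[of "y - x" x] r unfolding r_def by linarith
      moreover have "x + ((y - x) + k) = y + k" "x + (y - x) = y"
        by auto
      ultimately show ?thesis
        unfolding blinfun.diff_left blinfun.add_right by (simp only:)
    qed
    have "norm (D y - D x) \<le> 4 * \<epsilon>"
    proof (rule norm_blinfun_bound)
      fix k
      show "norm ((D y - D x) k) \<le> 4 * \<epsilon> * norm k"
      proof (cases "k = 0")
        case False
        have "norm ((r / norm k) *\<^sub>R k) = r"
          using False r by simp
        from main[OF this] have "(r / norm k) * \<bar>(D y - D x) k\<bar> \<le> 4 * \<epsilon> * r"
          using r by (simp add: blinfun.scaleR_right abs_mult del: norm_scaleR)
        with False r show ?thesis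
          by (simp add: field_simps)
      qed simp
    qed (use \<open>\<epsilon> > 0\<close> in simp)
    with \<open>e > 0\<close> show ?thesis
      by (simp add: dist_norm \<epsilon>_def)
  qed (use \<open>e > 0\<close> in simp)
  with \<open>\<delta> > 0\<close> show "\<exists>\<delta>>0. \<forall>x\<in>UNIV. \<forall>y\<in>UNIV. dist y x < \<delta> \<longrightarrow> dist (D y) (D x) < e"
    by (intro exI[of _ "\<delta> / 2"]) auto
qed

lemma uniformly_continuous_on_subset:
  fixes f :: "'a::metric_space \<Rightarrow> 'b::metric_space"
  assumes "uniformly_continuous_on S f" "T \<subseteq> S"
  shows "uniformly_continuous_on T f"
  using assms unfolding uniformly_continuous_on_def by (meson subsetD)

lemma DF_eqI:
  assumes "(F has_derivative blinfun_apply L) (at x)"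
  shows "DF F x = L"
  unfolding DF_def frechet_derivative_at[OF assms, symmetric] by (rule blinfun_apply_inverse)

section \<open>Moduli of continuity\<close>

text \<open>
  The argument is a distance, but the modulus is taken on all of \<open>\<real>\<close> (even, by the first clause), so
  that differences can be inserted without sign conditions. Nonnegativity and \<open>\<beta> 0 = 0\<close> follow.
\<close>

definition bounded_modulus :: "(real \<Rightarrow> real) \<Rightarrow> bool" where
  "bounded_modulus \<beta> \<longleftrightarrow>
     (\<forall>s t. \<bar>s\<bar> \<le> \<bar>t\<bar> \<longrightarrow> \<beta> s \<le> \<beta> t) \<and> (\<forall>s t. \<beta> (s + t) \<le> \<beta> s + \<beta> t) \<and>
     (\<forall>\<epsilon>>0. \<exists>\<delta>>0. \<beta> \<delta> \<le> \<epsilon>) \<and> (\<exists>M. \<forall>t. \<beta> t \<le> M)"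

lemma bounded_modulus_nonneg:
  assumes "bounded_modulus \<beta>"
  shows "0 \<le> \<beta> t"
proof -
  have "\<beta> (0 + 0) \<le> \<beta> 0 + \<beta> 0" "\<beta> 0 \<le> \<beta> t"
    using assms unfolding bounded_modulus_def by (blast, simp)
  then show ?thesis
    by simp
qed

lemma bounded_modulus_diff:
  assumes "bounded_modulus \<beta>"
  shows "\<bar>\<beta> s - \<beta> t\<bar> \<le> \<beta> (s - t)"
proof -
  have "\<beta> (t + (s - t)) \<le> \<beta> t + \<beta> (s - t)" "\<beta> (s + (t - s)) \<le> \<beta> s + \<beta> (t - s)"
    "\<beta> (t - s) \<le> \<beta> (s - t)"
    using assms unfolding bounded_modulus_def by (blast, blast, simp)
  then show ?thesis
    by simp
qed

text \<open>
  An infimum of increasing affine functions is subadditive: of two of them, take the sum of the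
  constants and the smaller slope. The hypotheses say that the infimum tends to \<open>0\<close> at \<open>0\<close> and is
  bounded.
\<close>

lemma modulus_envelope:
  fixes P :: "(real \<times> real) set"
  assumes nonneg: "\<And>e k. (e, k) \<in> P \<Longrightarrow> 0 \<le> e \<and> 0 \<le> k"
    and small: "\<And>\<epsilon>. \<epsilon> > 0 \<Longrightarrow> \<exists>k. (\<epsilon>, k) \<in> P"
    and bound: "(M, 0) \<in> P"
  shows "bounded_modulus (\<lambda>t. INF p\<in>P. fst p + snd p * \<bar>t\<bar>)"
proof -
  define \<beta> where "\<beta> t = (INF p\<in>P. fst p + snd p * \<bar>t\<bar>)" for t
  have ne: "P \<noteq> {}"
    using bound by auto
  have bdd: "bdd_below ((\<lambda>p. fst p + snd p * \<bar>t\<bar>) ` P)" for t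
    by (rule bdd_belowI2[where m = 0]) (use nonneg in auto)
  have le: "\<beta> t \<le> e + k * \<bar>t\<bar>" if "(e, k) \<in> P" for e k t
    unfolding \<beta>_def using cINF_lower[OF bdd that] by simp
  have ge: "b \<le> \<beta> t" if "\<And>e k. (e, k) \<in> P \<Longrightarrow> b \<le> e + k * \<bar>t\<bar>" for b t
    unfolding \<beta>_def using that by (intro cINF_greatest ne) auto
  have "\<beta> s \<le> \<beta> t" if "\<bar>s\<bar> \<le> \<bar>t\<bar>" for s t
  proof (rule ge)
    fix e k assume ek: "(e, k) \<in> P"
    then have "k * \<bar>s\<bar> \<le> k * \<bar>t\<bar>"
      using nonneg that by (intro mult_left_mono) auto
    with le[OF ek, of s] show "\<beta> s \<le> e + k * \<bar>t\<bar>"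
      by linarith
  qed
  moreover have "\<beta> (s + t) \<le> \<beta> s + \<beta> t" for s t
  proof -
    have *: "\<beta> (s + t) \<le> (e + k * \<bar>s\<bar>) + (e' + k' * \<bar>t\<bar>)"
      if "(e, k) \<in> P" "(e', k') \<in> P" for e k e' k'
    proof -
      have pos: "0 \<le> e" "0 \<le> k" "0 \<le> e'" "0 \<le> k'"
        using nonneg that by auto
      have "min k k' * \<bar>s + t\<bar> \<le> min k k' * (\<bar>s\<bar> + \<bar>t\<bar>)"
        using pos by (intro mult_left_mono) auto
      also have "\<dots> \<le> k * \<bar>s\<bar> + k' * \<bar>t\<bar>"
        by (simp add: distrib_left add_mono mult_right_mono)
      finally have "min k k' * \<bar>s + t\<bar> \<le> k * \<bar>s\<bar> + k' * \<bar>t\<bar>" .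
      moreover have "\<beta> (s + t) \<le> e + e' + min k k' * \<bar>s + t\<bar>"
        using le[OF that(1), of "s + t"] le[OF that(2), of "s + t"] pos
        by (cases "k \<le> k'") (auto simp: min_def)
      ultimately show ?thesis
        by linarith
    qed
    have "\<beta> (s + t) - \<beta> s \<le> \<beta> t"
    proof (rule ge)
      fix e' k' assume ek': "(e', k') \<in> P"
      have "\<beta> (s + t) - (e' + k' * \<bar>t\<bar>) \<le> \<beta> s"
        by (rule ge) (use *[OF _ ek'] in fastforce)
      then show "\<beta> (s + t) - \<beta> s \<le> e' + k' * \<bar>t\<bar>"
        by simp
    qed
    then show ?thesis
      by simp
  qed
  moreover have "\<exists>\<delta>>0. \<beta> \<delta> \<le> \<epsilon>" if "\<epsilon> > 0" for \<epsilon>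
  proof -
    obtain k where k: "(\<epsilon> / 2, k) \<in> P"
      using small[of "\<epsilon> / 2"] \<open>\<epsilon> > 0\<close> by auto
    then have "0 \<le> k"
      using nonneg by blast
    define \<delta> where "\<delta> = \<epsilon> / (2 * (k + 1))"
    have "\<delta> > 0"
      using \<open>\<epsilon> > 0\<close> \<open>0 \<le> k\<close> by (simp add: \<delta>_def)
    moreover have "k * \<delta> \<le> (k + 1) * \<delta>"
      using \<open>\<delta> > 0\<close> by simp
    moreover have "(k + 1) * \<delta> = \<epsilon> / 2"
      using \<open>0 \<le> k\<close> by (simp add: \<delta>_def field_simps)
    ultimately show ?thesis
      using le[OF k, of \<delta>] by (intro exI[of _ \<delta>]) auto
  qed
  moreover have "\<forall>t. \<beta> t \<le> M"
    using le[OF bound] by simp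
  ultimately show ?thesis
    unfolding bounded_modulus_def \<beta>_def[symmetric] by blast
qed

lemma modulus_antiderivative:
  assumes \<beta>: "bounded_modulus \<beta>"
  obtains \<eta> :: "real \<Rightarrow> real" where "\<And>t. (\<eta> has_real_derivative \<beta> t) (at t)"
proof -
  have "isCont \<beta> t" for t
    unfolding isCont_def LIM_def
  proof (intro allI impI)
    fix r :: real assume "r > 0"
    have "r / 2 > 0"
      using \<open>r > 0\<close> by simp
    then obtain \<delta> where \<delta>: "\<delta> > 0" "\<beta> \<delta> \<le> r / 2"
      using \<beta> unfolding bounded_modulus_def by meson
    have "dist (\<beta> s) (\<beta> t) < r" if "dist s t < \<delta>" for s
    proof -
      have "\<beta> (s - t) \<le> \<beta> \<delta>"
        using \<beta> that \<open>\<delta> > 0\<close> by (auto simp: bounded_modulus_def dist_real_def)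
      with bounded_modulus_diff[OF \<beta>, of s t] \<delta> \<open>r > 0\<close> show ?thesis
        by (simp add: dist_real_def)
    qed
    with \<open>\<delta> > 0\<close> show "\<exists>\<delta>>0. \<forall>s. s \<noteq> t \<and> dist s t < \<delta> \<longrightarrow> dist (\<beta> s) (\<beta> t) < r"
      by blast
  qed
  then obtain \<eta> where "\<forall>t. (\<eta> has_vector_derivative \<beta> t) (at t)"
    using einterval_antiderivative[of "-\<infinity>" "\<infinity>" \<beta>] by auto
  then show thesis
    by (intro that[of \<eta>]) (simp add: has_real_derivative_iff_has_vector_derivative)
qed

lemma antiderivative_taylor:
  assumes \<beta>: "bounded_modulus \<beta>"
    and \<eta>: "\<And>t. (\<eta> has_real_derivative \<beta> t) (at t)"
  shows "\<bar>\<eta> a - \<eta> c - \<beta> c * (a - c)\<bar> \<le> \<beta> (a - c) * \<bar>a - c\<bar>"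
proof (cases "a = c")
  case False
  have "\<exists>\<xi>. \<bar>\<xi> - c\<bar> \<le> \<bar>a - c\<bar> \<and> \<eta> a - \<eta> c = (a - c) * \<beta> \<xi>"
  proof (cases "c < a")
    case True
    then obtain \<xi> where "c < \<xi>" "\<xi> < a" "\<eta> a - \<eta> c = (a - c) * \<beta> \<xi>"
      using MVT2[of c a \<eta> \<beta>] \<eta> by blast
    then show ?thesis
      by (intro exI[of _ \<xi>]) auto
  next
    case *: False
    with False have "a < c"
      by simp
    then obtain \<xi> where "a < \<xi>" "\<xi> < c" "\<eta> c - \<eta> a = (c - a) * \<beta> \<xi>"
      using MVT2[of a c \<eta> \<beta>] \<eta> by blast
    then show ?thesis
      by (intro exI[of _ \<xi>]) (auto simp: algebra_simps)
  qed
  then obtain \<xi> where \<xi>: "\<bar>\<xi> - c\<bar> \<le> \<bar>a - c\<bar>" "\<eta> a - \<eta> c = (a - c) * \<beta> \<xi>"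
    by blast
  have "\<bar>\<beta> \<xi> - \<beta> c\<bar> \<le> \<beta> (\<xi> - c)"
    by (rule bounded_modulus_diff[OF \<beta>])
  also have "\<dots> \<le> \<beta> (a - c)"
    using \<beta> \<xi>(1) by (auto simp: bounded_modulus_def)
  finally have "\<bar>\<beta> \<xi> - \<beta> c\<bar> * \<bar>a - c\<bar> \<le> \<beta> (a - c) * \<bar>a - c\<bar>"
    by (rule mult_right_mono) simp
  then show ?thesis
    by (simp add: \<xi>(2) flip: abs_mult) (simp add: algebra_simps)
qed (use bounded_modulus_nonneg[OF \<beta>] in simp)

text \<open>
  Boundedness of the jet turns the local estimates of \<open>(W\<^sub>G)\<close> into estimates for all distances:
  for every \<open>\<epsilon>\<close> there is a slope \<open>k\<close> such that the affine function \<open>\<epsilon> + k r\<close> is a majorant at all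
  distances \<open>r\<close>, and some constant is one as well. The modulus is the infimum of all affine majorants.
\<close>

lemma cond_W_modulus:
  fixes f :: "'a::real_normed_vector \<Rightarrow> real" and G :: "'a \<Rightarrow> ('a \<Rightarrow>\<^sub>L real)"
  assumes "bounded (f ` E)" "bounded (G ` E)" "cond_W f E G"
  obtains \<beta> where "bounded_modulus \<beta>"
    "\<And>x y. x \<in> E \<Longrightarrow> y \<in> E \<Longrightarrow> \<bar>f y - f x - G x (y - x)\<bar> \<le> \<beta> (norm (y - x)) * norm (y - x)"
    "\<And>x y. x \<in> E \<Longrightarrow> y \<in> E \<Longrightarrow> norm (G y - G x) \<le> \<beta> (norm (y - x))"
proof -
  obtain A where A: "\<And>x. x \<in> E \<Longrightarrow> \<bar>f x\<bar> \<le> A"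
    using assms(1) by (auto simp: bounded_iff)
  obtain B where B: "\<And>x. x \<in> E \<Longrightarrow> norm (G x) \<le> B"
    using assms(2) by (auto simp: bounded_iff)
  define R where "R x y = \<bar>f y - f x - G x (y - x)\<bar>" for x y
  define P where "P = {(e, k). 0 \<le> e \<and> 0 \<le> k \<and> (\<forall>x\<in>E. \<forall>y\<in>E.
      R x y \<le> (e + k * norm (y - x)) * norm (y - x) \<and> norm (G y - G x) \<le> e + k * norm (y - x))}"
  have key: "\<exists>\<delta>>0. \<exists>c\<ge>0. \<forall>x\<in>E. \<forall>y\<in>E.
      (norm (y - x) < \<delta> \<longrightarrow> R x y \<le> \<epsilon> * norm (y - x) \<and> norm (G y - G x) \<le> \<epsilon>) \<and>
      (\<delta> \<le> norm (y - x) \<longrightarrow> R x y \<le> c * norm (y - x) \<and> norm (G y - G x) \<le> c)"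
    if "\<epsilon> > 0" for \<epsilon>
  proof -
    obtain \<delta>\<^sub>1 where "\<delta>\<^sub>1 > 0" and \<delta>\<^sub>1: "\<And>x y. x \<in> E \<Longrightarrow> y \<in> E \<Longrightarrow> norm (y - x) < \<delta>\<^sub>1 \<Longrightarrow>
        R x y \<le> \<epsilon> * norm (y - x)"
      using assms(3) \<open>\<epsilon> > 0\<close> unfolding cond_W_def R_def by meson
    obtain \<delta>\<^sub>2 where "\<delta>\<^sub>2 > 0" and \<delta>\<^sub>2: "\<And>x y. x \<in> E \<Longrightarrow> y \<in> E \<Longrightarrow> norm (y - x) < \<delta>\<^sub>2 \<Longrightarrow>
        norm (G y - G x) \<le> \<epsilon>"
      using assms(3) \<open>\<epsilon> > 0\<close> unfolding cond_W_def uniformly_continuous_on_def dist_norm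
      by (meson less_imp_le)
    define \<delta> where "\<delta> = min \<delta>\<^sub>1 \<delta>\<^sub>2"
    have "\<delta> > 0"
      using \<open>\<delta>\<^sub>1 > 0\<close> \<open>\<delta>\<^sub>2 > 0\<close> by (simp add: \<delta>_def)
    \<comment> \<open>At distances \<open>r \<ge> \<delta>\<close>, \<open>f\<close> contributes at most \<open>2 |A| \<le> (2 |A| / \<delta>) r\<close>.\<close>
    define c where "c = 2 * \<bar>A\<bar> / \<delta> + 2 * \<bar>B\<bar>"
    have "c \<ge> 0"
      using \<open>\<delta> > 0\<close> by (simp add: c_def)
    have far: "R x y \<le> c * norm (y - x) \<and> norm (G y - G x) \<le> c"
      if E: "x \<in> E" "y \<in> E" and "\<delta> \<le> norm (y - x)" for x y
    proof
      have "norm (G x (y - x)) \<le> norm (G x) * norm (y - x)"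
        by (rule norm_blinfun)
      also have "\<dots> \<le> \<bar>B\<bar> * norm (y - x)"
        using B[OF E(1)] by (intro mult_right_mono) auto
      finally have "R x y \<le> 2 * \<bar>A\<bar> + \<bar>B\<bar> * norm (y - x)"
        using A[OF E(1)] A[OF E(2)] by (simp add: R_def)
      moreover have "2 * \<bar>A\<bar> \<le> 2 * \<bar>A\<bar> / \<delta> * norm (y - x)"
        using mult_left_mono[OF that(3), of "2 * \<bar>A\<bar>"] \<open>\<delta> > 0\<close> by (simp add: field_simps)
      moreover have "\<bar>B\<bar> * norm (y - x) \<le> 2 * \<bar>B\<bar> * norm (y - x)"
        by (intro mult_right_mono) auto
      ultimately show "R x y \<le> c * norm (y - x)"
        unfolding c_def distrib_right by linarith
      have "norm (G y - G x) \<le> 2 * \<bar>B\<bar>"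
        using norm_triangle_ineq4[of "G y" "G x"] B[OF E(1)] B[OF E(2)] by simp
      also have "\<dots> \<le> c"
        using \<open>\<delta> > 0\<close> by (simp add: c_def)
      finally show "norm (G y - G x) \<le> c" .
    qed
    show ?thesis
      by (rule exI[of _ \<delta>], intro conjI[OF \<open>\<delta> > 0\<close>] exI[of _ c] conjI[OF \<open>c \<ge> 0\<close>])
        (use \<delta>\<^sub>1 \<delta>\<^sub>2 far in \<open>auto simp: \<delta>_def\<close>)
  qed
  have "\<exists>k. (\<epsilon>, k) \<in> P" if "\<epsilon> > 0" for \<epsilon>
  proof -
    obtain \<delta> c where "\<delta> > 0" "c \<ge> 0" and
      near: "\<And>x y. x \<in> E \<Longrightarrow> y \<in> E \<Longrightarrow> norm (y - x) < \<delta> \<Longrightarrow>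
        R x y \<le> \<epsilon> * norm (y - x) \<and> norm (G y - G x) \<le> \<epsilon>" and
      far: "\<And>x y. x \<in> E \<Longrightarrow> y \<in> E \<Longrightarrow> \<delta> \<le> norm (y - x) \<Longrightarrow>
        R x y \<le> c * norm (y - x) \<and> norm (G y - G x) \<le> c"
      using key[OF \<open>\<epsilon> > 0\<close>] by blast
    have "R x y \<le> (\<epsilon> + c / \<delta> * norm (y - x)) * norm (y - x)
        \<and> norm (G y - G x) \<le> \<epsilon> + c / \<delta> * norm (y - x)" if E: "x \<in> E" "y \<in> E" for x y
    proof (cases "norm (y - x) < \<delta>")
      case True
      have "\<epsilon> \<le> \<epsilon> + c / \<delta> * norm (y - x)"
        using \<open>\<delta> > 0\<close> \<open>c \<ge> 0\<close> by simp
      then show ?thesis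
        using near[OF E True] by (meson mult_right_mono norm_ge_zero order_trans)
    next
      case False
      then have "\<delta> \<le> norm (y - x)"
        by simp
      then have "c \<le> c / \<delta> * norm (y - x)"
        using mult_left_mono[of \<delta> "norm (y - x)" c] \<open>\<delta> > 0\<close> \<open>c \<ge> 0\<close> by (simp add: field_simps)
      then have "c \<le> \<epsilon> + c / \<delta> * norm (y - x)"
        using \<open>\<epsilon> > 0\<close> by linarith
      then show ?thesis
        using far[OF E \<open>\<delta> \<le> norm (y - x)\<close>] by (meson mult_right_mono norm_ge_zero order_trans)
    qed
    then have "(\<epsilon>, c / \<delta>) \<in> P"
      using \<open>\<epsilon> > 0\<close> \<open>\<delta> > 0\<close> \<open>c \<ge> 0\<close> by (simp add: P_def)
    then show ?thesis ..
  qed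
  moreover obtain M where "(M, 0) \<in> P"
  proof -
    obtain \<delta> c where "\<delta> > 0" "c \<ge> 0" and
      near: "\<And>x y. x \<in> E \<Longrightarrow> y \<in> E \<Longrightarrow> norm (y - x) < \<delta> \<Longrightarrow>
        R x y \<le> 1 * norm (y - x) \<and> norm (G y - G x) \<le> 1" and
      far: "\<And>x y. x \<in> E \<Longrightarrow> y \<in> E \<Longrightarrow> \<delta> \<le> norm (y - x) \<Longrightarrow>
        R x y \<le> c * norm (y - x) \<and> norm (G y - G x) \<le> c"
      using key[of 1] by (auto simp: Ball_def)
    have "R x y \<le> (1 + c) * norm (y - x) \<and> norm (G y - G x) \<le> 1 + c" if E: "x \<in> E" "y \<in> E" for x y
    proof -
      have "0 \<le> c * norm (y - x)"
        using \<open>c \<ge> 0\<close> by simp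
      moreover have "R x y \<le> 1 * norm (y - x) \<and> norm (G y - G x) \<le> 1 \<or>
          R x y \<le> c * norm (y - x) \<and> norm (G y - G x) \<le> c"
        using near[OF E] far[OF E] by linarith
      ultimately show ?thesis
        unfolding distrib_right using \<open>c \<ge> 0\<close> norm_ge_zero[of "y - x"] by linarith
    qed
    then have "(1 + c, 0) \<in> P"
      using \<open>c \<ge> 0\<close> by (simp add: P_def)
    then show ?thesis
      by (rule that)
  qed
  moreover have "\<And>e k. (e, k) \<in> P \<Longrightarrow> 0 \<le> e \<and> 0 \<le> k"
    by (auto simp: P_def)
  ultimately have modulus: "bounded_modulus (\<lambda>t. INF p\<in>P. fst p + snd p * \<bar>t\<bar>)" (is "bounded_modulus ?\<beta>")
    by (intro modulus_envelope)
  have ge: "b \<le> ?\<beta> t" if "\<And>e k. (e, k) \<in> P \<Longrightarrow> b \<le> e + k * \<bar>t\<bar>" for b t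
    using that \<open>(M, 0) \<in> P\<close> by (intro cINF_greatest) auto
  show thesis
  proof (rule that[OF modulus])
    fix x y assume E: "x \<in> E" "y \<in> E"
    show "norm (G y - G x) \<le> ?\<beta> (norm (y - x))"
      by (rule ge) (use E in \<open>auto simp: P_def\<close>)
    show "\<bar>f y - f x - G x (y - x)\<bar> \<le> ?\<beta> (norm (y - x)) * norm (y - x)"
    proof (cases "y = x")
      case False
      have "R x y / norm (y - x) \<le> ?\<beta> (norm (y - x))"
        by (rule ge) (use E False in \<open>auto simp: P_def pos_divide_le_eq\<close>)
      with False show ?thesis
        by (simp add: R_def pos_divide_le_eq)
    qed simp
  qed
qed

section \<open>A semiconcave gauge from a uniformly smooth norm\<close>

lemma uniformly_smooth_homogeneous:
  assumes N: "equivalent_norm N" "uniformly_smooth N" and "\<epsilon> > 0"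
  shows "\<exists>\<delta>>0. \<forall>x h. N h \<le> \<delta> * N x \<longrightarrow> N (x + h) + N (x - h) \<le> 2 * N x + \<epsilon> * N h"
proof -
  have scale: "N (c *\<^sub>R x) = \<bar>c\<bar> * N x" for c x
    using N by (simp add: equivalent_norm_def)
  have zero: "N x = 0 \<longleftrightarrow> x = 0" for x
    using N by (simp add: equivalent_norm_def)
  have nonneg: "N x \<ge> 0" for x
  proof -
    obtain a where "a > 0" "a * norm x \<le> N x"
      using N by (auto simp: equivalent_norm_def)
    then show ?thesis
      by (meson less_eq_real_def mult_nonneg_nonneg norm_ge_zero order_trans)
  qed
  obtain \<delta> where "\<delta> > 0"
    and \<delta>: "\<And>x h. N x = 1 \<Longrightarrow> N h \<le> \<delta> \<Longrightarrow> N (x + h) + N (x - h) \<le> 2 + \<epsilon> * N h"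
    using N(2) \<open>\<epsilon> > 0\<close> unfolding uniformly_smooth_def by meson
  have "N (x + h) + N (x - h) \<le> 2 * N x + \<epsilon> * N h" if "N h \<le> \<delta> * N x" for x h
  proof (cases "x = 0")
    case True
    with that have "N h \<le> 0"
      using zero[of 0] by simp
    then have "h = 0"
      using nonneg[of h] zero by force
    with True zero[of 0] show ?thesis
      by simp
  next
    case False
    define c where "c = N x"
    have c: "c > 0"
      using False nonneg[of x] zero[of x] by (simp add: c_def)
    define u k where "u = (1 / c) *\<^sub>R x" and "k = (1 / c) *\<^sub>R h"
    have "N u = 1" "N k = N h / c"
      using c by (simp_all add: u_def k_def scale c_def)
    then have *: "N (u + k) + N (u - k) \<le> 2 + \<epsilon> * (N h / c)"
      using \<delta>[of u k] that c by (simp add: c_def field_simps)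
    have "x + h = c *\<^sub>R (u + k)" "x - h = c *\<^sub>R (u - k)"
      using c by (simp_all add: u_def k_def scaleR_right_distrib scaleR_right_diff_distrib)
    then have "N (x + h) + N (x - h) = c * (N (u + k) + N (u - k))"
      using c by (simp add: scale distrib_left)
    also have "\<dots> \<le> c * (2 + \<epsilon> * (N h / c))"
      using * c by (intro mult_left_mono) auto
    also have "\<dots> = 2 * N x + \<epsilon> * N h"
      using c by (simp add: c_def field_simps)
    finally show ?thesis .
  qed
  with \<open>\<delta> > 0\<close> show ?thesis
    by blast
qed

text \<open>
  For a convex function the gap at every ratio \<open>t\<close> is controlled by the symmetric second difference,
  since the one-sided difference quotients increase with the step. This is how uniform smoothness,
  which speaks of symmetric differences only, yields semiconcavity without differentiating the norm.
\<close>

lemma jensen_gap_convex_le: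
  assumes convex: "\<And>x y t. 0 \<le> t \<Longrightarrow> t \<le> 1 \<Longrightarrow> p (t *\<^sub>R x + (1 - t) *\<^sub>R y) \<le> t * p x + (1 - t) * p y"
    and t: "0 \<le> t" "t \<le> 1"
  shows "jensen_gap p t h z \<le> t * (1 - t) * (p (z + h) + p (z - h) - 2 * p z)"
proof -
  have "p (z + (1 - t) *\<^sub>R h) \<le> (1 - t) * p (z + h) + (1 - (1 - t)) * p z"
    using convex[of "1 - t" "z + h" z] t by (simp add: algebra_simps)
  then have "t * p (z + (1 - t) *\<^sub>R h) \<le> t * ((1 - t) * p (z + h) + t * p z)"
    using t by (intro mult_left_mono) auto
  moreover have "p (z - t *\<^sub>R h) \<le> t * p (z - h) + (1 - t) * p z"
    using convex[of t "z - h" z] t by (simp add: algebra_simps)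
  then have "(1 - t) * p (z - t *\<^sub>R h) \<le> (1 - t) * (t * p (z - h) + (1 - t) * p z)"
    using t by (intro mult_left_mono) auto
  ultimately show ?thesis
    by (simp add: jensen_gap_def algebra_simps)
qed

text \<open>
  With \<open>\<eta>' = \<beta>\<close> and \<open>p\<close> a multiple of the norm \<open>N\<close>, put \<open>\<phi> = 2 (\<eta> \<circ> p - \<eta> 0)\<close>. Expanding \<open>\<eta>\<close> at
  \<open>c = p z\<close>, the gap of \<open>\<eta> \<circ> p\<close> is \<open>\<beta> c\<close> times the gap of \<open>p\<close>, up to at most \<open>2 t (1 - t) \<beta>(p h) p h\<close>.
  The norm is not smooth at \<open>0\<close>, but this does no harm: if \<open>p h\<close> is small compared with \<open>c\<close>,
  uniform smoothness applies; otherwise \<open>c\<close> is as small as \<open>p h\<close> up to a factor, and so \<open>\<beta> c\<close> is small.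
\<close>

lemma smooth_gauge:
  fixes N :: "'a::real_normed_vector \<Rightarrow> real"
  assumes N: "equivalent_norm N" "uniformly_smooth N" and \<beta>: "bounded_modulus \<beta>"
  obtains \<phi> :: "'a \<Rightarrow> real" and C where
    "\<And>z. 3 * norm z * \<beta> (2 * norm z) \<le> \<phi> z" "\<And>z. \<phi> z \<le> C * norm z"
    "uniformly_semiconcave \<phi>"
proof -
  note \<beta>_nonneg = bounded_modulus_nonneg[OF \<beta>]
  have mono: "\<beta> s \<le> \<beta> t" if "\<bar>s\<bar> \<le> \<bar>t\<bar>" for s t
    using \<beta> that by (simp add: bounded_modulus_def)
  have \<beta>_small: "\<exists>\<delta>>0. \<beta> \<delta> \<le> \<epsilon>" if "\<epsilon> > 0" for \<epsilon>
    using \<beta> that by (simp add: bounded_modulus_def)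
  obtain M where M: "\<And>t. \<beta> t \<le> M"
    using \<beta> by (auto simp: bounded_modulus_def)
  then have "0 \<le> M"
    using \<beta>_nonneg order_trans by blast
  obtain \<eta> where \<eta>: "\<And>t. (\<eta> has_real_derivative \<beta> t) (at t)"
    using modulus_antiderivative[OF \<beta>] by blast
  have \<eta>_mono: "\<eta> s \<le> \<eta> t" if "s \<le> t" for s t
    using that by (rule DERIV_nonneg_imp_nondecreasing) (use \<eta> \<beta>_nonneg in blast)
  obtain a b where ab: "a > 0" "b > 0" "\<And>x. a * norm x \<le> N x" "\<And>x. N x \<le> b * norm x"
    using N by (auto simp: equivalent_norm_def)
  \<comment> \<open>The factor makes \<open>p z \<ge> 4 |z|\<close>, so that \<open>\<eta>\<close> grows by at least \<open>2 |z| \<beta>(2|z|)\<close> up to \<open>p z\<close>.\<close>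
  define p where "p x = 4 / a * N x" for x
  define B where "B = 4 * b / a"
  have "B > 0"
    using ab by (simp add: B_def)
  have p_lower: "4 * norm x \<le> p x" and p_upper: "p x \<le> B * norm x" for x
    using ab(1) ab(3)[of x] ab(4)[of x] by (simp_all add: p_def B_def field_simps)
  have p_nonneg: "0 \<le> p x" for x
    using p_lower[of x] norm_ge_zero[of x] by linarith
  have p_scale: "p (c *\<^sub>R x) = \<bar>c\<bar> * p x" for c x
    using N by (simp add: equivalent_norm_def p_def)
  have p_triangle: "p (x + y) \<le> p x + p y" for x y
  proof -
    have "4 / a * N (x + y) \<le> 4 / a * (N x + N y)"
      using N ab(1) by (intro mult_left_mono) (auto simp: equivalent_norm_def)
    then show ?thesis
      by (simp add: p_def distrib_left)
  qed
  have p_diff: "\<bar>p (x + h) - p x\<bar> \<le> p h" for x h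
    using p_triangle[of x h] p_triangle[of "x + h" "- h"] p_scale[of "-1" h] by simp
  have p_convex: "p (t *\<^sub>R x + (1 - t) *\<^sub>R y) \<le> t * p x + (1 - t) * p y"
    if "0 \<le> t" "t \<le> 1" for t x y
    using p_triangle[of "t *\<^sub>R x" "(1 - t) *\<^sub>R y"] that by (simp add: p_scale)
  have p_smooth: "\<exists>\<delta>>0. \<forall>x h. p h \<le> \<delta> * p x \<longrightarrow> p (x + h) + p (x - h) - 2 * p x \<le> \<epsilon> * p h"
    if "\<epsilon> > 0" for \<epsilon>
  proof -
    obtain \<delta> where "\<delta> > 0" and
      \<delta>: "\<And>x h. N h \<le> \<delta> * N x \<Longrightarrow> N (x + h) + N (x - h) \<le> 2 * N x + \<epsilon> * N h"
      using uniformly_smooth_homogeneous[OF N \<open>\<epsilon> > 0\<close>] by blast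
    have "p (x + h) + p (x - h) - 2 * p x \<le> \<epsilon> * p h" if "p h \<le> \<delta> * p x" for x h
    proof -
      have "N h \<le> \<delta> * N x"
        using that ab(1) by (simp add: p_def field_simps)
      then have "4 / a * (N (x + h) + N (x - h)) \<le> 4 / a * (2 * N x + \<epsilon> * N h)"
        using ab(1) by (intro mult_left_mono \<delta>) auto
      then show ?thesis
        by (simp add: p_def algebra_simps)
    qed
    with \<open>\<delta> > 0\<close> show ?thesis
      by blast
  qed
  define \<phi> where "\<phi> z = 2 * (\<eta> (p z) - \<eta> 0)" for z
  have "3 * norm z * \<beta> (2 * norm z) \<le> \<phi> z" for z
  proof (cases "z = 0")
    case False
    define s where "s = 2 * norm z"
    have "0 < s"
      using False by (simp add: s_def)
    then obtain \<xi> where \<xi>: "s < \<xi>" "\<xi> < 2 * s" "\<eta> (2 * s) - \<eta> s = (2 * s - s) * \<beta> \<xi>"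
      using MVT2[of s "2 * s" \<eta> \<beta>] \<eta> by auto
    have "s * \<beta> s \<le> s * \<beta> \<xi>"
      using \<xi> \<open>0 < s\<close> by (intro mult_left_mono mono) auto
    moreover have "\<eta> 0 \<le> \<eta> s" "\<eta> (2 * s) \<le> \<eta> (p z)"
      using \<open>0 < s\<close> p_lower[of z] by (auto intro!: \<eta>_mono simp: s_def)
    ultimately have "2 * (s * \<beta> s) \<le> \<phi> z"
      using \<xi>(3) by (simp add: \<phi>_def)
    moreover have "3 * norm z * \<beta> s \<le> 2 * (s * \<beta> s)"
      using mult_right_mono[of "3 * norm z" "4 * norm z" "\<beta> s"] \<beta>_nonneg[of s] by (simp add: s_def)
    ultimately show ?thesis
      by (simp add: s_def)
  qed (use \<eta>_mono[OF p_nonneg[of 0]] in \<open>simp add: \<phi>_def\<close>)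
  moreover have "\<phi> z \<le> (4 * M * B) * norm z" for z
  proof -
    have "\<eta> (p z) - \<eta> 0 - \<beta> 0 * (p z - 0) \<le> \<beta> (p z - 0) * \<bar>p z - 0\<bar>"
      using antiderivative_taylor[OF \<beta> \<eta>, of "p z" 0] by linarith
    also have "\<dots> \<le> M * p z"
      using p_nonneg[of z] by (simp add: M mult_right_mono)
    finally have "\<eta> (p z) - \<eta> 0 \<le> M * p z + M * p z"
      using mult_right_mono[OF M[of 0] p_nonneg[of z]] by simp
    moreover have "M * p z \<le> M * (B * norm z)"
      using p_upper \<open>0 \<le> M\<close> by (intro mult_left_mono) auto
    ultimately show ?thesis
      by (simp add: \<phi>_def)
  qed
  moreover have "uniformly_semiconcave \<phi>"
    unfolding uniformly_semiconcave_def
  proof (intro allI impI)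
    fix \<epsilon> :: real assume "\<epsilon> > 0"
    define e where "e = \<epsilon> / (8 * B)"
    have "e > 0"
      using \<open>\<epsilon> > 0\<close> \<open>B > 0\<close> by (simp add: e_def)
    then have "e / (M + 1) > 0"
      using \<open>0 \<le> M\<close> by simp
    from p_smooth[OF this] obtain \<delta>\<^sub>1 where "\<delta>\<^sub>1 > 0" and \<delta>\<^sub>1: "\<And>x h. p h \<le> \<delta>\<^sub>1 * p x \<Longrightarrow>
        p (x + h) + p (x - h) - 2 * p x \<le> e / (M + 1) * p h"
      by blast
    obtain \<delta>\<^sub>2 where \<delta>\<^sub>2: "\<delta>\<^sub>2 > 0" "\<beta> \<delta>\<^sub>2 \<le> e"
      using \<beta>_small[OF \<open>e > 0\<close>] by blast
    \<comment> \<open>For \<open>|h| \<le> \<delta>\<close> both \<open>p h \<le> \<delta>\<^sub>2\<close> and \<open>p h \<le> \<delta>\<^sub>1 * \<delta>\<^sub>2\<close>; the latter forces \<open>p z \<le> \<delta>\<^sub>2\<close> when \<open>p h > \<delta>\<^sub>1 * p z\<close>.\<close>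
    define \<delta> where "\<delta> = min \<delta>\<^sub>2 (\<delta>\<^sub>1 * \<delta>\<^sub>2) / B"
    have "\<delta> > 0"
      using \<open>\<delta>\<^sub>1 > 0\<close> \<open>\<delta>\<^sub>2 > 0\<close> \<open>B > 0\<close> by (simp add: \<delta>_def)
    have "jensen_gap \<phi> t h z \<le> \<epsilon> * (t * (1 - t) * norm h)"
      if t: "0 \<le> t" "t \<le> 1" and "norm h \<le> \<delta>" for t h z
    proof -
      define r where "r = p h"
      have "r \<le> B * \<delta>"
        using p_upper[of h] mult_left_mono[OF \<open>norm h \<le> \<delta>\<close>, of B] \<open>B > 0\<close>
        unfolding r_def by linarith
      also have "\<dots> = min \<delta>\<^sub>2 (\<delta>\<^sub>1 * \<delta>\<^sub>2)"
        using \<open>B > 0\<close> by (simp add: \<delta>_def)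
      finally have r: "0 \<le> r" "r \<le> \<delta>\<^sub>2" "r \<le> \<delta>\<^sub>1 * \<delta>\<^sub>2"
        using p_nonneg by (auto simp: r_def)
      define c where "c = p z"
      have "0 \<le> c"
        by (simp add: c_def p_nonneg)
      define x y where "x = p (z + (1 - t) *\<^sub>R h)" and "y = p (z - t *\<^sub>R h)"
      have xc: "\<bar>x - c\<bar> \<le> (1 - t) * r" and yc: "\<bar>y - c\<bar> \<le> t * r"
        using p_diff[of z "(1 - t) *\<^sub>R h"] p_diff[of z "- (t *\<^sub>R h)"] p_scale[of "- t" h] t
        by (simp_all add: x_def y_def c_def r_def p_scale)
      have remainder: "\<eta> w \<le> \<eta> c + \<beta> c * (w - c) + e * (s * r)"
        if "\<bar>w - c\<bar> \<le> s * r" "0 \<le> s" "s \<le> 1" for w s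
      proof -
        have "s * r \<le> 1 * r"
          using that r by (intro mult_right_mono) auto
        then have "\<beta> (w - c) \<le> \<beta> \<delta>\<^sub>2"
          using that r by (intro mono) linarith
        then have "\<beta> (w - c) * \<bar>w - c\<bar> \<le> e * (s * r)"
          using that \<delta>\<^sub>2 \<open>e > 0\<close> by (intro mult_mono) auto
        with antiderivative_taylor[OF \<beta> \<eta>, of w c] show ?thesis
          by linarith
      qed
      have kernel: "\<beta> c * (p (z + h) + p (z - h) - 2 * c) \<le> 2 * e * r"
      proof (cases "r \<le> \<delta>\<^sub>1 * c")
        case True
        then have "p (z + h) + p (z - h) - 2 * c \<le> e / (M + 1) * r"
          unfolding r_def c_def by (rule \<delta>\<^sub>1)
        then have "\<beta> c * (p (z + h) + p (z - h) - 2 * c) \<le> \<beta> c * (e / (M + 1) * r)"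
          by (intro mult_left_mono \<beta>_nonneg)
        also have "\<dots> \<le> (M + 1) * (e / (M + 1) * r)"
          using M[of c] \<open>0 \<le> M\<close> \<open>e > 0\<close> r by (intro mult_right_mono) auto
        also have "\<dots> = e * r"
          using \<open>0 \<le> M\<close> by simp
        also have "\<dots> \<le> 2 * e * r"
          using \<open>e > 0\<close> r by simp
        finally show ?thesis .
      next
        case False
        then have "\<delta>\<^sub>1 * c \<le> \<delta>\<^sub>1 * \<delta>\<^sub>2"
          using r by linarith
        then have "c \<le> \<delta>\<^sub>2"
          using \<open>\<delta>\<^sub>1 > 0\<close> by simp
        then have "\<beta> c \<le> e"
          using mono[of c \<delta>\<^sub>2] \<open>0 \<le> c\<close> \<delta>\<^sub>2 by simp
        moreover have "p (z + h) + p (z - h) - 2 * c \<le> 2 * r"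
          using p_diff[of z h] p_diff[of z "- h"] p_scale[of "-1" h] by (simp add: c_def r_def)
        ultimately have "\<beta> c * (p (z + h) + p (z - h) - 2 * c) \<le> \<beta> c * (2 * r)"
          "\<beta> c * (2 * r) \<le> e * (2 * r)"
          using r by (auto intro!: mult_left_mono mult_right_mono \<beta>_nonneg)
        then show ?thesis
          by simp
      qed
      have "jensen_gap p t h z \<le> t * (1 - t) * (p (z + h) + p (z - h) - 2 * c)"
        unfolding c_def by (rule jensen_gap_convex_le[OF p_convex t])
      then have "\<beta> c * (t * x + (1 - t) * y - c)
          \<le> \<beta> c * (t * (1 - t) * (p (z + h) + p (z - h) - 2 * c))"
        by (intro mult_left_mono \<beta>_nonneg) (simp add: jensen_gap_def x_def y_def c_def)
      also have "\<dots> = t * (1 - t) * (\<beta> c * (p (z + h) + p (z - h) - 2 * c))"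
        by simp
      also have "\<dots> \<le> t * (1 - t) * (2 * e * r)"
        using t by (intro mult_left_mono kernel) auto
      finally have first: "\<beta> c * (t * x + (1 - t) * y - c) \<le> t * (1 - t) * (2 * e * r)" .
      have "t * \<eta> x \<le> t * (\<eta> c + \<beta> c * (x - c) + e * ((1 - t) * r))"
        "(1 - t) * \<eta> y \<le> (1 - t) * (\<eta> c + \<beta> c * (y - c) + e * (t * r))"
        using t xc yc by (auto intro!: mult_left_mono remainder)
      then have "t * \<eta> x + (1 - t) * \<eta> y - \<eta> c
          \<le> \<beta> c * (t * x + (1 - t) * y - c) + t * (1 - t) * (2 * e * r)"
        by (simp add: algebra_simps)
      with first have "t * \<eta> x + (1 - t) * \<eta> y - \<eta> c \<le> t * (1 - t) * (4 * e * r)"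
        by simp
      moreover have "jensen_gap \<phi> t h z = 2 * (t * \<eta> x + (1 - t) * \<eta> y - \<eta> c)"
        by (simp add: jensen_gap_def \<phi>_def x_def y_def c_def algebra_simps)
      ultimately have "jensen_gap \<phi> t h z \<le> t * (1 - t) * (8 * e * r)"
        by simp
      also have "\<dots> \<le> t * (1 - t) * (8 * e * (B * norm h))"
        using t \<open>e > 0\<close> p_upper[of h] by (intro mult_left_mono) (auto simp: r_def)
      also have "\<dots> = \<epsilon> * (t * (1 - t) * norm h)"
        using \<open>B > 0\<close> by (simp add: e_def)
      finally show ?thesis .
    qed
    with \<open>\<delta> > 0\<close> show "\<exists>\<delta>>0. \<forall>t h z. 0 \<le> t \<and> t \<le> 1 \<and> norm h \<le> \<delta> \<longrightarrow>
        jensen_gap \<phi> t h z \<le> \<epsilon> * (t * (1 - t) * norm h)"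
      by blast
  qed
  ultimately show thesis
    by (rule that)
qed

section \<open>Extension of bounded jets\<close>

text \<open>
  Only \<open>f\<close> and \<open>G\<close> are bounded, not \<open>E\<close>: the bump functions below are obtained from an unbounded \<open>E\<close>.
  The upper function \<open>g\<close> is \<open>u 1\<close> and the lower one \<open>l\<close> is \<open>- u (- 1)\<close>, so that both are infima
  of the same kind.
\<close>

proposition whitney_extension_bounded_jet:
  fixes N f :: "'a::real_normed_vector \<Rightarrow> real" and G :: "'a \<Rightarrow> ('a \<Rightarrow>\<^sub>L real)"
  assumes N: "equivalent_norm N" "uniformly_smooth N"
    and jet: "bounded (f ` E)" "bounded (G ` E)" "cond_W f E G"
  obtains F where "F \<in> C1plusB UNIV" "\<And>x. x \<in> E \<Longrightarrow> F x = f x" "\<And>x. x \<in> E \<Longrightarrow> DF F x = G x"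
proof (cases "E = {}")
  case True
  have "((\<lambda>x. 0) has_derivative blinfun_apply 0) (at x)" for x :: 'a
    by (simp add: zero_blinfun.rep_eq)
  then have "DF (\<lambda>x::'a. 0) = (\<lambda>x. 0)"
    by (intro ext DF_eqI)
  then have "(\<lambda>x::'a. 0) \<in> C1plusB UNIV"
    by (simp add: C1plusB_def uniformly_continuous_on_const)
  with True that show thesis
    by blast
next
  case False
  then obtain y\<^sub>0 where y\<^sub>0: "y\<^sub>0 \<in> E"
    by blast
  obtain \<beta> where \<beta>: "bounded_modulus \<beta>"
    and f_bound: "\<And>x y. x \<in> E \<Longrightarrow> y \<in> E \<Longrightarrow> \<bar>f y - f x - G x (y - x)\<bar> \<le> \<beta> (norm (y - x)) * norm (y - x)"
    and G_bound: "\<And>x y. x \<in> E \<Longrightarrow> y \<in> E \<Longrightarrow> norm (G y - G x) \<le> \<beta> (norm (y - x))"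
    using cond_W_modulus[OF jet] by blast
  obtain \<phi> :: "'a \<Rightarrow> real" and C where \<phi>_lower: "\<And>z. 3 * norm z * \<beta> (2 * norm z) \<le> \<phi> z"
    and \<phi>_upper: "\<And>z. \<phi> z \<le> C * norm z"
    and \<phi>_semiconcave: "uniformly_semiconcave \<phi>"
    using smooth_gauge[OF N \<beta>] by blast
  note \<beta>_nonneg = bounded_modulus_nonneg[OF \<beta>]
  have \<beta>_mono: "\<beta> s \<le> \<beta> t" if "\<bar>s\<bar> \<le> \<bar>t\<bar>" for s t
    using \<beta> that by (simp add: bounded_modulus_def)
  have \<phi>_nonneg: "0 \<le> \<phi> z" for z
    using \<phi>_lower[of z] \<beta>_nonneg[of "2 * norm z"]
    by (meson mult_nonneg_nonneg norm_ge_zero order_trans zero_le_numeral)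
  have \<phi>_zero: "\<phi> 0 = 0"
    using \<phi>_upper[of 0] \<phi>_nonneg[of 0] by simp
  have \<phi>_small: "\<exists>\<delta>>0. \<forall>h. norm h \<le> \<delta> \<longrightarrow> \<phi> h \<le> \<epsilon> * norm h" if "\<epsilon> > 0" for \<epsilon>
  proof -
    obtain \<delta> where "\<delta> > 0" and \<delta>: "\<And>t h z. 0 \<le> t \<Longrightarrow> t \<le> 1 \<Longrightarrow> norm h \<le> \<delta> \<Longrightarrow>
        jensen_gap \<phi> t h z \<le> \<epsilon> * (t * (1 - t) * norm h)"
      using uniformly_semiconcaveD[OF \<phi>_semiconcave \<open>\<epsilon> > 0\<close>] by auto
    \<comment> \<open>Semiconcavity at the minimum \<open>0\<close> of \<open>\<phi>\<close>, with midpoint \<open>0\<close> of \<open>h\<close> and \<open>- h\<close>.\<close>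
    have "\<phi> h \<le> \<epsilon> * norm h" if "norm h \<le> \<delta> / 2" for h
      using \<delta>[of "1/2" "2 *\<^sub>R h" 0] that \<phi>_nonneg[of "- h"] \<phi>_zero by (simp add: jensen_gap_def)
    with \<open>\<delta> > 0\<close> show ?thesis
      by (intro exI[of _ "\<delta> / 2"]) auto
  qed
  define J where "J y x = f y + G y (x - y)" for x y
  have compatible: "J y x \<le> J z x + \<phi> (x - y) + \<phi> (x - z)" if E: "y \<in> E" "z \<in> E" for x y z
  proof -
    \<comment> \<open>The longer of \<open>x - y\<close> and \<open>x - z\<close>; the term \<open>\<phi> w\<close> alone absorbs the incompatibility of the two jets.\<close>
    define w where "w = (if norm (x - y) \<le> norm (x - z) then x - z else x - y)"
    have w: "norm (x - y) \<le> norm w" "norm (x - z) \<le> norm w" "\<phi> w \<le> \<phi> (x - y) + \<phi> (x - z)"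
      using \<phi>_nonneg by (auto simp: w_def)
    have yz: "norm (z - y) \<le> 2 * norm w"
      using norm_triangle_ineq4[of "x - y" "x - z"] w by simp
    have "\<beta> (norm (z - y)) * norm (z - y) \<le> \<beta> (2 * norm w) * (2 * norm w)"
      using yz by (intro mult_mono \<beta>_mono \<beta>_nonneg) auto
    moreover have "norm ((G z - G y) (x - z)) \<le> \<beta> (2 * norm w) * norm w"
    proof -
      have "norm ((G z - G y) (x - z)) \<le> norm (G z - G y) * norm (x - z)"
        by (rule norm_blinfun)
      also have "\<dots> \<le> \<beta> (2 * norm w) * norm w"
      proof (intro mult_mono w \<beta>_nonneg)
        have "norm (G z - G y) \<le> \<beta> (norm (z - y))"
          by (rule G_bound[OF E])
        also have "\<dots> \<le> \<beta> (2 * norm w)"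
          using yz by (intro \<beta>_mono) auto
        finally show "norm (G z - G y) \<le> \<beta> (2 * norm w)" .
      qed auto
      finally show ?thesis .
    qed
    moreover have "J y x - J z x = - (f z - f y - G y (z - y)) - (G z - G y) (x - z)"
      by (simp add: J_def blinfun.diff_left blinfun.diff_right)
    moreover have "3 * norm w * \<beta> (2 * norm w)
        = \<beta> (2 * norm w) * (2 * norm w) + \<beta> (2 * norm w) * norm w"
      by (simp add: algebra_simps)
    ultimately have "J y x - J z x \<le> 3 * norm w * \<beta> (2 * norm w)"
      using f_bound[OF E] unfolding real_norm_def by linarith
    with \<phi>_lower[of w] w(3) show ?thesis
      by linarith
  qed
  define p where "p s y x = s * J y x + \<phi> (x - y)" for s y x
  have p_gap: "jensen_gap (p s y) t h z = jensen_gap \<phi> t h (z - y)" for s y t h z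
  proof -
    have "z + (1 - t) *\<^sub>R h - y = z - y + (1 - t) *\<^sub>R h" "z - t *\<^sub>R h - y = z - y - t *\<^sub>R h"
      by simp_all
    then show ?thesis
      by (simp only: jensen_gap_def p_def J_def blinfun.add_right blinfun.diff_right blinfun.scaleR_right)
        (simp add: algebra_simps)
  qed
  define u where "u s x = (INF y\<in>E. p s y x)" for s x
  have bdd: "bdd_below ((\<lambda>y. p s y x) ` E)" if "s = 1 \<or> s = - 1" for s x
  proof (rule bdd_belowI2)
    show "s * J y\<^sub>0 x - \<phi> (x - y\<^sub>0) \<le> p s y x" if "y \<in> E" for y
      using compatible[OF that y\<^sub>0, of x] compatible[OF y\<^sub>0 that, of x] \<open>s = 1 \<or> s = - 1\<close>
      by (auto simp: p_def)
  qed
  have u_le: "u s x \<le> p s y x" if "s = 1 \<or> s = - 1" "y \<in> E" for s x y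
    unfolding u_def by (rule cINF_lower[OF bdd that(2)]) (rule that)
  have u_gap: "jensen_gap (u s) t h z \<le> c"
    if "s = 1 \<or> s = - 1" "0 \<le> t" "t \<le> 1" "\<And>z. jensen_gap \<phi> t h z \<le> c" for s t h z c
    unfolding u_def
    by (rule jensen_gap_INF_le[OF False bdd]) (use that in \<open>auto simp: p_gap\<close>)
  have "- u (- 1) x \<le> u 1 x" for x
  proof -
    have "- u 1 x \<le> u (- 1) x"
      unfolding u_def[of "- 1"]
    proof (rule cINF_greatest[OF False])
      fix y assume y: "y \<in> E"
      have "- p (- 1) y x \<le> u 1 x"
        unfolding u_def
        by (rule cINF_greatest[OF False]) (use compatible[OF y, of _ x] in \<open>force simp: p_def\<close>)
      then show "- u 1 x \<le> p (- 1) y x"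
        by simp
    qed
    then show ?thesis
      by simp
  qed
  then obtain F where F_ge: "\<And>x. - u (- 1) x \<le> F x" and F_le: "\<And>x. F x \<le> u 1 x"
    and F_gap: "\<forall>t\<in>{0..1}. \<forall>h c. (\<forall>z. jensen_gap (u 1) t h z \<le> c) \<and>
      (\<forall>z. - c \<le> jensen_gap (\<lambda>x. - u (- 1) x) t h z) \<longrightarrow> (\<forall>z. \<bar>jensen_gap F t h z\<bar> \<le> c)"
    using jensen_insertion[of "\<lambda>x. - u (- 1) x" "u 1"] by metis
  have F_jet: "\<bar>F x - J y x\<bar> \<le> \<phi> (x - y)" if "y \<in> E" for x y
    using F_ge[of x] F_le[of x] u_le[of 1 y x] u_le[of "- 1" y x] that
    by (simp add: p_def)
  have F_semiconcave: "uniformly_semiconcave (\<lambda>x. s * F x)" if s: "s = 1 \<or> s = - 1" for s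
    unfolding uniformly_semiconcave_def
  proof (intro allI impI)
    fix \<epsilon> :: real assume "\<epsilon> > 0"
    obtain \<delta> where "\<delta> > 0" and \<delta>: "\<And>t h z. 0 \<le> t \<Longrightarrow> t \<le> 1 \<Longrightarrow> norm h \<le> \<delta> \<Longrightarrow>
        jensen_gap \<phi> t h z \<le> \<epsilon> * (t * (1 - t) * norm h)"
      using uniformly_semiconcaveD[OF \<phi>_semiconcave \<open>\<epsilon> > 0\<close>] by auto
    have "jensen_gap (\<lambda>x. s * F x) t h z \<le> \<epsilon> * (t * (1 - t) * norm h)"
      if t: "0 \<le> t" "t \<le> 1" "norm h \<le> \<delta>" for t h z
    proof -
      have "jensen_gap (u s) t h w \<le> \<epsilon> * (t * (1 - t) * norm h)" if "s = 1 \<or> s = - 1" for s w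
        by (rule u_gap[OF that t(1,2)]) (rule \<delta>[OF t])
      moreover have "jensen_gap (\<lambda>x. - u (- 1) x) t h w = - jensen_gap (u (- 1)) t h w" for w
        by (simp add: jensen_gap_def)
      ultimately have "\<bar>jensen_gap F t h z\<bar> \<le> \<epsilon> * (t * (1 - t) * norm h)"
        using F_gap t(1,2) by simp
      moreover have "jensen_gap (\<lambda>x. s * F x) t h z = s * jensen_gap F t h z"
        by (simp add: jensen_gap_def algebra_simps)
      ultimately show ?thesis
        using s by auto
    qed
    with \<open>\<delta> > 0\<close> show "\<exists>\<delta>>0. \<forall>t h z. 0 \<le> t \<and> t \<le> 1 \<and> norm h \<le> \<delta> \<longrightarrow>
        jensen_gap (\<lambda>x. s * F x) t h z \<le> \<epsilon> * (t * (1 - t) * norm h)"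
      by blast
  qed
  obtain D :: "'a \<Rightarrow> ('a \<Rightarrow>\<^sub>L real)" where taylor: "uniform_taylor F D"
  proof (rule taylor_of_semiconcave)
    show "uniformly_semiconcave F" "uniformly_semiconcave (\<lambda>x. - F x)"
      using F_semiconcave[of 1] F_semiconcave[of "- 1"] by simp_all
    fix x
    have "\<bar>F (x + h)\<bar> \<le> \<bar>f y\<^sub>0\<bar> + (norm (G y\<^sub>0) + \<bar>C\<bar>) * (norm (x - y\<^sub>0) + 1)" if "norm h \<le> 1" for h
    proof -
      define v where "v = x + h - y\<^sub>0"
      have "norm v \<le> norm (x - y\<^sub>0) + 1"
        using norm_triangle_ineq[of "x - y\<^sub>0" h] that by (simp add: v_def algebra_simps)
      then have "(norm (G y\<^sub>0) + \<bar>C\<bar>) * norm v \<le> (norm (G y\<^sub>0) + \<bar>C\<bar>) * (norm (x - y\<^sub>0) + 1)"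
        by (intro mult_left_mono) auto
      moreover have "\<phi> v \<le> \<bar>C\<bar> * norm v"
        using \<phi>_upper[of v] mult_right_mono[OF abs_ge_self[of C] norm_ge_zero[of v]] by linarith
      moreover have "\<bar>G y\<^sub>0 v\<bar> \<le> norm (G y\<^sub>0) * norm v"
        using norm_blinfun[of "G y\<^sub>0" v] by simp
      moreover have "\<bar>F (x + h) - (f y\<^sub>0 + G y\<^sub>0 v)\<bar> \<le> \<phi> v"
        using F_jet[OF y\<^sub>0, of "x + h"] by (simp add: J_def v_def)
      ultimately show ?thesis
        by (simp add: distrib_right)
    qed
    then show "\<exists>C. \<forall>h. norm h \<le> 1 \<longrightarrow> \<bar>F (x + h)\<bar> \<le> C"
      by blast
  qed
  have D: "(F has_derivative blinfun_apply (D x)) (at x)" for x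
    by (rule has_derivative_of_taylor[OF taylor])
  then have DF_F: "DF F = D"
    by (intro ext DF_eqI)
  show thesis
  proof (rule that)
    have "uniformly_continuous_on UNIV D"
      by (rule uniformly_continuous_of_taylor[OF taylor])
    then have "uniformly_continuous_on B D" for B
      by (rule uniformly_continuous_on_subset) simp
    then show "F \<in> C1plusB UNIV"
      using D by (auto simp: C1plusB_def DF_F differentiable_def)
    fix y assume y: "y \<in> E"
    show F_y: "F y = f y"
      using F_jet[OF y, of y] by (simp add: J_def \<phi>_zero blinfun.zero_right)
    show "DF F y = G y"
    proof (rule DF_eqI)
      show "(F has_derivative blinfun_apply (G y)) (at y)"
        unfolding has_derivative_at_alt
      proof (intro conjI allI impI)
        show "bounded_linear (blinfun_apply (G y))"
          by (rule blinfun.bounded_linear_right)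
        fix \<epsilon> :: real assume "\<epsilon> > 0"
        from \<phi>_small[OF this] obtain \<delta> where "\<delta> > 0" and \<delta>: "\<And>h. norm h \<le> \<delta> \<Longrightarrow> \<phi> h \<le> \<epsilon> * norm h"
          by blast
        have "norm (F x - F y - G y (x - y)) \<le> \<epsilon> * norm (x - y)" if "norm (x - y) < \<delta>" for x
          using F_jet[OF y, of x] \<delta>[of "x - y"] that by (simp add: J_def F_y)
        with \<open>\<delta> > 0\<close> show "\<exists>\<delta>>0. \<forall>x. norm (x - y) < \<delta> \<longrightarrow>
            norm (F x - F y - G y (x - y)) \<le> \<epsilon> * norm (x - y)"
          by blast
      qed
    qed
  qed
qed

section \<open>Functions with derivative uniformly continuous on bounded sets\<close>

lemma C1plusB_has_derivative:
  assumes "F \<in> C1plusB UNIV"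
  shows "(F has_derivative blinfun_apply (DF F x)) (at x)"
proof -
  have "(F has_derivative frechet_derivative F (at x)) (at x)"
    using assms by (simp add: C1plusB_def flip: frechet_derivative_works)
  then show ?thesis
    by (simp add: DF_def bounded_linear_Blinfun_apply has_derivative_bounded_linear)
qed

lemma C1plusB_uniformly_continuous:
  assumes "F \<in> C1plusB UNIV" "bounded B"
  shows "uniformly_continuous_on B (DF F)"
  using assms by (simp add: C1plusB_def)

lemma C1plusB_I:
  fixes F :: "'a::real_normed_vector \<Rightarrow> real"
  assumes "\<And>x. (F has_derivative blinfun_apply (D x)) (at x)"
    and "\<And>r. uniformly_continuous_on (cball 0 r) D"
  shows "F \<in> C1plusB UNIV"
proof -
  have "DF F = D"
    using assms(1) by (intro ext DF_eqI)
  moreover have "uniformly_continuous_on B D" if "bounded B" for B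
  proof -
    obtain r where "\<forall>x\<in>B. norm x \<le> r"
      using \<open>bounded B\<close> by (auto simp: bounded_iff)
    then have "B \<subseteq> cball 0 r"
      by auto
    then show ?thesis
      using assms(2) uniformly_continuous_on_subset by blast
  qed
  ultimately show ?thesis
    using assms(1) by (auto simp: C1plusB_def differentiable_def)
qed

text \<open>
  In infinite dimensions a ball is not compact. It is convex, however, so that from \<open>0\<close> every point is
  reached in a fixed number of steps so short that the derivative changes by less than \<open>1\<close> in each.
\<close>

lemma C1plusB_DF_bounded:
  fixes F :: "'a::real_normed_vector \<Rightarrow> real"
  assumes "F \<in> C1plusB UNIV"
  obtains C where "0 \<le> C" "\<And>x. x \<in> cball 0 r \<Longrightarrow> norm (DF F x) \<le> C"
proof -
  have "uniformly_continuous_on (cball 0 r) (DF F)"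
    using assms by (rule C1plusB_uniformly_continuous) simp
  then obtain \<delta> where "\<delta> > 0" and \<delta>: "\<And>x y. x \<in> cball 0 r \<Longrightarrow> y \<in> cball 0 r \<Longrightarrow> dist y x < \<delta> \<Longrightarrow>
      dist (DF F y) (DF F x) < 1"
    by (rule uniformly_continuous_onE[of _ _ 1]) (auto simp: Ball_def)
  obtain n where n: "\<bar>r\<bar> / \<delta> < real n"
    using reals_Archimedean2 by blast
  then have "n > 0"
    using \<open>\<delta> > 0\<close> by (metis abs_ge_zero divide_nonneg_pos less_le_trans not_gr_zero not_less of_nat_0)
  have "norm (DF F x) \<le> norm (DF F 0) + n" if x: "x \<in> cball 0 r" for x
  proof -
    have "norm x \<le> r"
      using x by simp
    have step: "norm (DF F ((real i / n) *\<^sub>R x)) \<le> norm (DF F 0) + i" if "i \<le> n" for i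
      using that
    proof (induction i)
      case (Suc i)
      have in_ball: "(real j / n) *\<^sub>R x \<in> cball 0 r" if "j \<le> n" for j
      proof -
        have "real j / n * norm x \<le> 1 * norm x"
          using that \<open>n > 0\<close> by (intro mult_right_mono) auto
        with \<open>norm x \<le> r\<close> show ?thesis
          by simp
      qed
      have "(real (Suc i) / n) *\<^sub>R x - (real i / n) *\<^sub>R x = (1 / n) *\<^sub>R x"
        by (simp add: add_divide_distrib flip: scaleR_left_diff_distrib)
      moreover have "norm ((1 / n) *\<^sub>R x) < \<delta>"
        using n \<open>n > 0\<close> \<open>\<delta> > 0\<close> \<open>norm x \<le> r\<close> by (simp add: field_simps)
      ultimately have "dist ((real (Suc i) / n) *\<^sub>R x) ((real i / n) *\<^sub>R x) < \<delta>"
        by (simp only: dist_norm)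
      then have "dist (DF F ((real (Suc i) / n) *\<^sub>R x)) (DF F ((real i / n) *\<^sub>R x)) < 1"
        using Suc.prems by (intro \<delta> in_ball) auto
      moreover have "norm (DF F ((real i / n) *\<^sub>R x)) \<le> norm (DF F 0) + i"
        using Suc by simp
      ultimately show ?case
        using norm_triangle_ineq2[of "DF F ((real (Suc i) / n) *\<^sub>R x)" "DF F ((real i / n) *\<^sub>R x)"]
        unfolding dist_norm by simp
    qed simp
    show ?thesis
      using step[of n] \<open>n > 0\<close> by simp
  qed
  then show thesis
    by (intro that[of "norm (DF F 0) + n"]) auto
qed

lemma C1plusB_lipschitz:
  fixes F :: "'a::real_normed_vector \<Rightarrow> real"
  assumes "F \<in> C1plusB UNIV"
  obtains C where "0 \<le> C" "\<And>x y. x \<in> cball 0 r \<Longrightarrow> y \<in> cball 0 r \<Longrightarrow> \<bar>F x - F y\<bar> \<le> C * norm (x - y)"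
proof -
  obtain C where C: "0 \<le> C" "\<And>x. x \<in> cball 0 r \<Longrightarrow> norm (DF F x) \<le> C"
    using C1plusB_DF_bounded[OF assms, of r] by blast
  have "norm (F x - F y) \<le> C * norm (x - y)" if "x \<in> cball 0 r" "y \<in> cball 0 r" for x y
  proof (rule differentiable_bound[of "cball 0 r" F "\<lambda>x. DF F x"])
    show "(F has_derivative blinfun_apply (DF F z)) (at z within cball 0 r)" for z
      using C1plusB_has_derivative[OF assms] by (rule has_derivative_at_withinI)
    show "onorm (blinfun_apply (DF F z)) \<le> C" if "z \<in> cball 0 r" for z
      using C(2)[OF that] by (simp add: norm_blinfun.rep_eq)
  qed (use that in auto)
  with C(1) that show thesis
    by auto
qed

lemma C1plusB_bounded:
  fixes F :: "'a::real_normed_vector \<Rightarrow> real"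
  assumes "F \<in> C1plusB UNIV"
  obtains A where "\<And>x. x \<in> cball 0 r \<Longrightarrow> \<bar>F x\<bar> \<le> A"
proof -
  obtain C where C: "0 \<le> C" "\<And>x y. x \<in> cball 0 r \<Longrightarrow> y \<in> cball 0 r \<Longrightarrow> \<bar>F x - F y\<bar> \<le> C * norm (x - y)"
    using C1plusB_lipschitz[OF assms, of r] by blast
  have "\<bar>F x\<bar> \<le> \<bar>F 0\<bar> + C * r" if "x \<in> cball 0 r" for x
  proof -
    have "norm x \<le> r"
      using that by simp
    then have "0 \<in> cball (0::'a) r" "C * norm x \<le> C * r"
      using C(1) norm_ge_zero[of x] by (simp_all add: mult_left_mono del: norm_ge_zero)
    with C(2)[OF that, of 0] show ?thesis
      by simp
  qed
  then show thesis
    by (rule that)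
qed

lemma C1plusB_taylor:
  fixes F :: "'a::real_normed_vector \<Rightarrow> real"
  assumes "F \<in> C1plusB UNIV" and "\<epsilon> > 0"
  shows "\<exists>\<delta>>0. \<forall>x\<in>cball 0 r. \<forall>y\<in>cball 0 r. norm (y - x) < \<delta> \<longrightarrow>
    \<bar>F y - F x - DF F x (y - x)\<bar> \<le> \<epsilon> * norm (y - x)"
proof -
  have "uniformly_continuous_on (cball 0 r) (DF F)"
    using assms(1) by (rule C1plusB_uniformly_continuous) simp
  then obtain \<delta> where "\<delta> > 0" and \<delta>: "\<And>x y. x \<in> cball 0 r \<Longrightarrow> y \<in> cball 0 r \<Longrightarrow> dist y x < \<delta> \<Longrightarrow>
      dist (DF F y) (DF F x) < \<epsilon>"
    using \<open>\<epsilon> > 0\<close> by (rule uniformly_continuous_onE) (auto simp: Ball_def)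
  have "\<bar>F y - F x - DF F x (y - x)\<bar> \<le> \<epsilon> * norm (y - x)"
    if xy: "x \<in> cball 0 r" "y \<in> cball 0 r" "norm (y - x) < \<delta>" for x y
  proof -
    have "norm (F y - F x - DF F x (y - x)) \<le> norm (y - x) * \<epsilon>"
    proof (rule differentiable_bound_linearization[where S = "closed_segment x y"])
      show "x + t *\<^sub>R (y - x) \<in> closed_segment x y" if "t \<in> {0..1}" for t
        using that by (auto simp: in_segment algebra_simps)
      show "(F has_derivative blinfun_apply (DF F z)) (at z within closed_segment x y)" for z
        using C1plusB_has_derivative[OF assms(1)] by (rule has_derivative_at_withinI)
      show "onorm (blinfun_apply (DF F z) - blinfun_apply (DF F x)) \<le> \<epsilon>" if z: "z \<in> closed_segment x y" for z
      proof -
        have "z \<in> cball 0 r"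
          using z xy closed_segment_subset[of x "cball 0 r" y] by auto
        moreover have "dist z x < \<delta>"
          using z xy(3) segment_bound1[OF z] by (simp add: dist_norm norm_minus_commute)
        ultimately have "norm (DF F z - DF F x) < \<epsilon>"
          using \<delta>[OF xy(1)] by (simp add: dist_norm)
        then show ?thesis
          by (simp add: norm_blinfun.rep_eq minus_blinfun.rep_eq fun_diff_def)
      qed
    qed simp
    then show ?thesis
      by (simp add: mult.commute)
  qed
  with \<open>\<delta> > 0\<close> show ?thesis
    by blast
qed

lemma uniformly_continuous_on_scaleR_bounded:
  fixes u :: "'a::metric_space \<Rightarrow> real" and w :: "'a \<Rightarrow> 'b::real_normed_vector"
  assumes u: "uniformly_continuous_on S u" "\<And>x. x \<in> S \<Longrightarrow> \<bar>u x\<bar> \<le> A"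
    and w: "uniformly_continuous_on S w" "\<And>x. x \<in> S \<Longrightarrow> norm (w x) \<le> B"
  shows "uniformly_continuous_on S (\<lambda>x. u x *\<^sub>R w x)"
  unfolding uniformly_continuous_on_def
proof (intro allI impI)
  fix \<epsilon> :: real assume "\<epsilon> > 0"
  define e where "e = \<epsilon> / (\<bar>A\<bar> + \<bar>B\<bar> + 1)"
  have "e > 0"
    using \<open>\<epsilon> > 0\<close> by (simp add: e_def add_nonneg_pos)
  obtain \<delta>\<^sub>1 where \<delta>\<^sub>1: "\<delta>\<^sub>1 > 0" "\<And>x y. x \<in> S \<Longrightarrow> y \<in> S \<Longrightarrow> dist y x < \<delta>\<^sub>1 \<Longrightarrow> dist (u y) (u x) < e"
    using u(1) \<open>e > 0\<close> unfolding uniformly_continuous_on_def by meson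
  obtain \<delta>\<^sub>2 where \<delta>\<^sub>2: "\<delta>\<^sub>2 > 0" "\<And>x y. x \<in> S \<Longrightarrow> y \<in> S \<Longrightarrow> dist y x < \<delta>\<^sub>2 \<Longrightarrow> dist (w y) (w x) < e"
    using w(1) \<open>e > 0\<close> unfolding uniformly_continuous_on_def by meson
  have "dist (u y *\<^sub>R w y) (u x *\<^sub>R w x) < \<epsilon>"
    if xy: "x \<in> S" "y \<in> S" and "dist y x < min \<delta>\<^sub>1 \<delta>\<^sub>2" for x y
  proof -
    have "\<bar>u y - u x\<bar> \<le> e" "norm (w y - w x) \<le> e"
      using \<delta>\<^sub>1(2)[OF xy] \<delta>\<^sub>2(2)[OF xy] that(3) by (simp_all add: dist_norm)
    then have "norm ((u y - u x) *\<^sub>R w y) \<le> e * \<bar>B\<bar>" "norm (u x *\<^sub>R (w y - w x)) \<le> \<bar>A\<bar> * e"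
      using u(2)[OF xy(1)] w(2)[OF xy(2)] by (auto intro!: mult_mono)
    then have "norm ((u y - u x) *\<^sub>R w y + u x *\<^sub>R (w y - w x)) \<le> e * \<bar>B\<bar> + \<bar>A\<bar> * e"
      by (meson add_mono norm_triangle_ineq order_trans)
    also have "e * \<bar>B\<bar> + \<bar>A\<bar> * e < e * (\<bar>A\<bar> + \<bar>B\<bar> + 1)"
      using \<open>e > 0\<close> by (simp add: algebra_simps)
    also have "\<dots> = \<epsilon>"
      by (simp add: e_def)
    also have "(u y - u x) *\<^sub>R w y + u x *\<^sub>R (w y - w x) = u y *\<^sub>R w y - u x *\<^sub>R w x"
      by (simp add: algebra_simps)
    finally show ?thesis
      by (simp add: dist_norm)
  qed
  with \<delta>\<^sub>1(1) \<delta>\<^sub>2(1) show "\<exists>\<delta>>0. \<forall>x\<in>S. \<forall>y\<in>S. dist y x < \<delta> \<longrightarrow> dist (u y *\<^sub>R w y) (u x *\<^sub>R w x) < \<epsilon>"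
    by (intro exI[of _ "min \<delta>\<^sub>1 \<delta>\<^sub>2"]) auto
qed

lemma C1plusB_scaleR_DF_uniformly_continuous:
  fixes u v :: "'a::real_normed_vector \<Rightarrow> real"
  assumes "u \<in> C1plusB UNIV" "v \<in> C1plusB UNIV"
  shows "uniformly_continuous_on (cball 0 r) (\<lambda>x. u x *\<^sub>R DF v x)"
proof -
  obtain A where A: "\<And>x. x \<in> cball 0 r \<Longrightarrow> \<bar>u x\<bar> \<le> A"
    using C1plusB_bounded[OF assms(1)] by blast
  obtain B where B: "\<And>x. x \<in> cball 0 r \<Longrightarrow> norm (DF v x) \<le> B"
    using C1plusB_DF_bounded[OF assms(2)] by blast
  obtain C where "0 \<le> C" and
    C: "\<And>x y. x \<in> cball 0 r \<Longrightarrow> y \<in> cball 0 r \<Longrightarrow> \<bar>u x - u y\<bar> \<le> C * norm (x - y)"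
    using C1plusB_lipschitz[OF assms(1)] by blast
  have "uniformly_continuous_on (cball 0 r) u"
    unfolding uniformly_continuous_on_def
  proof (intro allI impI)
    fix \<epsilon> :: real assume "\<epsilon> > 0"
    have "dist (u y) (u x) < \<epsilon>"
      if "x \<in> cball 0 r" "y \<in> cball 0 r" "dist y x < \<epsilon> / (C + 1)" for x y
    proof -
      have "\<bar>u y - u x\<bar> \<le> C * dist y x"
        using C[OF that(2,1)] by (simp add: dist_norm)
      also have "\<dots> \<le> (C + 1) * dist y x"
        by (intro mult_right_mono) auto
      also have "\<dots> < \<epsilon>"
        using that(3) \<open>0 \<le> C\<close> by (simp add: field_simps)
      finally show ?thesis
        by (simp add: dist_real_def)
    qed
    then show "\<exists>\<delta>>0. \<forall>x\<in>cball 0 r. \<forall>y\<in>cball 0 r. dist y x < \<delta> \<longrightarrow> dist (u y) (u x) < \<epsilon>"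
      using \<open>\<epsilon> > 0\<close> \<open>0 \<le> C\<close> by (intro exI[of _ "\<epsilon> / (C + 1)"]) auto
  qed
  then show ?thesis
    using A B C1plusB_uniformly_continuous[OF assms(2) bounded_cball]
    by (intro uniformly_continuous_on_scaleR_bounded)
qed

lemma C1plusB_diff:
  fixes u v :: "'a::real_normed_vector \<Rightarrow> real"
  assumes "u \<in> C1plusB UNIV" "v \<in> C1plusB UNIV"
  shows "(\<lambda>x. u x - v x) \<in> C1plusB UNIV" and "DF (\<lambda>x. u x - v x) x = DF u x - DF v x"
proof -
  have *: "((\<lambda>x. u x - v x) has_derivative blinfun_apply (DF u x - DF v x)) (at x)" for x
    using has_derivative_diff[OF assms[THEN C1plusB_has_derivative]]
    by (simp add: minus_blinfun.rep_eq fun_diff_def)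
  show "DF (\<lambda>x. u x - v x) x = DF u x - DF v x"
    by (rule DF_eqI[OF *])
  show "(\<lambda>x. u x - v x) \<in> C1plusB UNIV"
    by (rule C1plusB_I[OF *])
      (intro uniformly_continuous_on_diff C1plusB_uniformly_continuous assms bounded_cball)
qed

lemma C1plusB_add:
  fixes u v :: "'a::real_normed_vector \<Rightarrow> real"
  assumes "u \<in> C1plusB UNIV" "v \<in> C1plusB UNIV"
  shows "(\<lambda>x. u x + v x) \<in> C1plusB UNIV" and "DF (\<lambda>x. u x + v x) x = DF u x + DF v x"
proof -
  have *: "((\<lambda>x. u x + v x) has_derivative blinfun_apply (DF u x + DF v x)) (at x)" for x
    using has_derivative_add[OF assms[THEN C1plusB_has_derivative]]
    by (simp add: plus_blinfun.rep_eq)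
  show "DF (\<lambda>x. u x + v x) x = DF u x + DF v x"
    by (rule DF_eqI[OF *])
  show "(\<lambda>x. u x + v x) \<in> C1plusB UNIV"
    by (rule C1plusB_I[OF *])
      (intro uniformly_continuous_on_add C1plusB_uniformly_continuous assms bounded_cball)
qed

lemma C1plusB_mult:
  fixes u v :: "'a::real_normed_vector \<Rightarrow> real"
  assumes "u \<in> C1plusB UNIV" "v \<in> C1plusB UNIV"
  shows "(\<lambda>x. u x * v x) \<in> C1plusB UNIV"
    and "DF (\<lambda>x. u x * v x) x = u x *\<^sub>R DF v x + v x *\<^sub>R DF u x"
proof -
  have *: "((\<lambda>x. u x * v x) has_derivative blinfun_apply (u x *\<^sub>R DF v x + v x *\<^sub>R DF u x)) (at x)" for x
    using has_derivative_mult[OF assms[THEN C1plusB_has_derivative]]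
    by (simp add: plus_blinfun.rep_eq scaleR_blinfun.rep_eq mult.commute)
  show "DF (\<lambda>x. u x * v x) x = u x *\<^sub>R DF v x + v x *\<^sub>R DF u x"
    by (rule DF_eqI[OF *])
  show "(\<lambda>x. u x * v x) \<in> C1plusB UNIV"
    by (rule C1plusB_I[OF *])
      (intro uniformly_continuous_on_add C1plusB_scaleR_DF_uniformly_continuous assms)
qed

lemma C1plusB_cond_W_tilde:
  fixes F :: "'a::real_normed_vector \<Rightarrow> real"
  assumes F: "F \<in> C1plusB UNIV" and eq: "\<And>x. x \<in> E \<Longrightarrow> F x = f x"
  shows "cond_W_tilde_with f E (DF F)"
  unfolding cond_W_tilde_with_def
proof (intro allI impI, elim conjE)
  fix B assume B: "B \<subseteq> E" "bounded B"
  then obtain r where "\<forall>x\<in>B. norm x \<le> r"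
    by (auto simp: bounded_iff)
  then have Br: "B \<subseteq> cball 0 r"
    by auto
  obtain A where A: "\<And>x. x \<in> cball 0 r \<Longrightarrow> \<bar>F x\<bar> \<le> A"
    using C1plusB_bounded[OF F] by blast
  have "bounded (f ` B)"
    using A Br B eq by (intro boundedI[where B = A]) force
  moreover obtain C where C: "\<And>x. x \<in> cball 0 r \<Longrightarrow> norm (DF F x) \<le> C"
    using C1plusB_DF_bounded[OF F] by blast
  have "bounded (DF F ` B)"
    using C Br by (intro boundedI[where B = C]) auto
  moreover have "uniformly_continuous_on B (DF F)"
    by (rule C1plusB_uniformly_continuous[OF F B(2)])
  moreover have "\<exists>\<delta>>0. \<forall>x\<in>B. \<forall>y\<in>B. norm (y - x) < \<delta> \<longrightarrow>
      \<bar>f y - f x - DF F x (y - x)\<bar> \<le> \<epsilon> * norm (y - x)" if "\<epsilon> > 0" for \<epsilon>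
  proof -
    obtain \<delta> where "\<delta> > 0" and \<delta>: "\<forall>x\<in>cball 0 r. \<forall>y\<in>cball 0 r. norm (y - x) < \<delta> \<longrightarrow>
        \<bar>F y - F x - DF F x (y - x)\<bar> \<le> \<epsilon> * norm (y - x)"
      using C1plusB_taylor[OF F \<open>\<epsilon> > 0\<close>] by blast
    have "\<bar>f y - f x - DF F x (y - x)\<bar> \<le> \<epsilon> * norm (y - x)"
      if xy: "x \<in> B" "y \<in> B" "norm (y - x) < \<delta>" for x y
    proof -
      have "F x = f x" "F y = f y"
        using xy B eq by auto
      moreover have "\<bar>F y - F x - DF F x (y - x)\<bar> \<le> \<epsilon> * norm (y - x)"
        using \<delta> xy Br by blast
      ultimately show ?thesis
        by simp
    qed
    with \<open>\<delta> > 0\<close> show ?thesis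
      by blast
  qed
  ultimately show "bounded (f ` B) \<and> bounded (DF F ` B) \<and> uniformly_continuous_on B (DF F) \<and>
      (\<forall>\<epsilon>>0. \<exists>\<delta>>0. \<forall>x\<in>B. \<forall>y\<in>B. norm (y - x) < \<delta> \<longrightarrow>
        \<bar>f y - f x - DF F x (y - x)\<bar> \<le> \<epsilon> * norm (y - x))"
    by blast
qed

lemma C1plusB_blend:
  fixes u v \<theta> :: "'a::real_normed_vector \<Rightarrow> real"
  assumes "u \<in> C1plusB UNIV" "v \<in> C1plusB UNIV" "\<theta> \<in> C1plusB UNIV"
  shows "(\<lambda>x. v x + \<theta> x * (u x - v x)) \<in> C1plusB UNIV"
    and "DF (\<lambda>x. v x + \<theta> x * (u x - v x)) x
      = DF v x + (\<theta> x *\<^sub>R (DF u x - DF v x) + (u x - v x) *\<^sub>R DF \<theta> x)"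
proof -
  note d = C1plusB_diff[OF assms(1,2)]
  note m = C1plusB_mult[OF assms(3) d(1)]
  show "(\<lambda>x. v x + \<theta> x * (u x - v x)) \<in> C1plusB UNIV"
    by (rule C1plusB_add(1)[OF assms(2) m(1)])
  show "DF (\<lambda>x. v x + \<theta> x * (u x - v x)) x
      = DF v x + (\<theta> x *\<^sub>R (DF u x - DF v x) + (u x - v x) *\<^sub>R DF \<theta> x)"
    using C1plusB_add(2)[OF assms(2) m(1)] by (simp add: m(2) d(2))
qed

section \<open>Gluing extensions from bounded pieces\<close>

text \<open>
  A bump is an extension of the jet that is \<open>1\<close> on the ball and \<open>0\<close> outside the larger ball, with zero
  derivative. The gap of width \<open>1\<close> between the two parts makes the condition trivial at distances
  below \<open>1\<close>.
\<close>

lemma smooth_bump: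
  fixes N :: "'a::real_normed_vector \<Rightarrow> real"
  assumes N: "equivalent_norm N" "uniformly_smooth N"
  obtains \<theta> :: "'a \<Rightarrow> real" where "\<theta> \<in> C1plusB UNIV"
    "\<And>x. norm x \<le> r \<Longrightarrow> \<theta> x = 1" "\<And>x. r + 1 \<le> norm x \<Longrightarrow> \<theta> x = 0 \<and> DF \<theta> x = 0"
proof -
  define E where "E = {x::'a. norm x \<le> r \<or> r + 1 \<le> norm x}"
  define f :: "'a \<Rightarrow> real" where "f x = (if norm x \<le> r then 1 else 0)" for x
  define G :: "'a \<Rightarrow> ('a \<Rightarrow>\<^sub>L real)" where "G x = 0" for x
  have "bounded (f ` E)"
    by (rule boundedI[where B = 1]) (auto simp: f_def)
  moreover have "bounded (G ` E)"
    by (rule boundedI[where B = 0]) (auto simp: G_def)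
  moreover have "cond_W f E G"
    unfolding cond_W_def
  proof (intro conjI allI impI)
    show "uniformly_continuous_on E G"
      unfolding G_def by (rule uniformly_continuous_on_const)
    fix \<epsilon> :: real assume "\<epsilon> > 0"
    have "\<bar>f y - f x - G x (y - x)\<bar> \<le> \<epsilon> * norm (y - x)"
      if "x \<in> E" "y \<in> E" "norm (y - x) < 1" for x y
    proof -
      have "f y = f x"
        using that norm_triangle_ineq2[of y x] norm_triangle_ineq2[of x y]
        by (auto simp: f_def E_def norm_minus_commute)
      with \<open>\<epsilon> > 0\<close> show ?thesis
        by (simp add: G_def)
    qed
    then show "\<exists>\<delta>>0. \<forall>x\<in>E. \<forall>y\<in>E. norm (y - x) < \<delta> \<longrightarrow>
        \<bar>f y - f x - G x (y - x)\<bar> \<le> \<epsilon> * norm (y - x)"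
      by (intro exI[of _ 1]) auto
  qed
  ultimately obtain \<theta> where \<theta>: "\<theta> \<in> C1plusB UNIV" "\<And>x. x \<in> E \<Longrightarrow> \<theta> x = f x"
    "\<And>x. x \<in> E \<Longrightarrow> DF \<theta> x = G x"
    using whitney_extension_bounded_jet[OF N] by blast
  then show thesis
    by (intro that[of \<theta>]) (auto simp: E_def f_def G_def)
qed

lemma C1plusB_of_locally_eq:
  fixes L :: "'a::real_normed_vector \<Rightarrow> real" and H :: "nat \<Rightarrow> 'a \<Rightarrow> real"
  assumes H: "\<And>n. H n \<in> C1plusB UNIV"
    and eq: "\<And>n x. norm x < real n \<Longrightarrow> L x = H n x"
  shows "L \<in> C1plusB UNIV" and "\<And>n x. norm x < real n \<Longrightarrow> DF L x = DF (H n) x"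
proof -
  have *: "(L has_derivative blinfun_apply (DF (H n) x)) (at x)" if "norm x < real n" for n x
  proof (rule has_derivative_transform_within_open)
    show "(H n has_derivative blinfun_apply (DF (H n) x)) (at x)"
      by (rule C1plusB_has_derivative[OF H])
    show "open (ball (0::'a) (real n))" "x \<in> ball 0 (real n)"
      using that by auto
    show "H n y = L y" if "y \<in> ball 0 (real n)" for y
      using that by (simp add: eq)
  qed
  show DF_L: "DF L x = DF (H n) x" if "norm x < real n" for n x
    by (rule DF_eqI[OF *[OF that]])
  show "L \<in> C1plusB UNIV"
  proof (rule C1plusB_I)
    fix x :: 'a
    obtain n where "norm x < real n"
      using reals_Archimedean2 by blast
    from *[OF this] DF_L[OF this] show "(L has_derivative blinfun_apply (DF L x)) (at x)"
      by simp
  next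
    fix r :: real
    obtain n where n: "r < real n"
      using reals_Archimedean2 by blast
    have "uniformly_continuous_on (cball 0 r) (DF (H n))"
      by (rule C1plusB_uniformly_continuous[OF H bounded_cball])
    moreover have "DF L x = DF (H n) x" if "x \<in> cball 0 r" for x
      using that n by (intro DF_L) simp
    ultimately show "uniformly_continuous_on (cball 0 r) (DF L)"
      by (simp add: uniformly_continuous_on_def)
  qed
qed

text \<open>
  Whatever value (and derivative) all the \<open>F n\<close> with \<open>|x| \<le> n\<close> share at \<open>x\<close> is inherited by the
  glued function. The approximants \<open>H n\<close> have this property for \<open>|x| \<le> n + 1\<close>; the next one
  keeps \<open>H n\<close> on the ball of radius \<open>n\<close> and passes to \<open>F (n + 2)\<close> before radius \<open>n + 1\<close>, so that the
  property extends to radius \<open>n + 2\<close> and the sequence is eventually constant on every ball.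
\<close>

lemma C1plusB_glue:
  fixes F :: "nat \<Rightarrow> 'a::real_normed_vector \<Rightarrow> real"
  assumes N: "equivalent_norm (N :: 'a \<Rightarrow> real)" "uniformly_smooth N"
    and F: "\<And>n. F n \<in> C1plusB UNIV"
  obtains L where "L \<in> C1plusB UNIV"
    "\<forall>x v. (\<forall>n. norm x \<le> real n \<longrightarrow> F n x = v) \<longrightarrow> L x = v"
    "\<forall>x v g. (\<forall>n. norm x \<le> real n \<longrightarrow> F n x = v \<and> DF (F n) x = g) \<longrightarrow> DF L x = g"
proof -
  have "\<exists>\<theta> :: nat \<Rightarrow> 'a \<Rightarrow> real. \<forall>n. \<theta> n \<in> C1plusB UNIV \<and>
      (\<forall>x. norm x \<le> real n \<longrightarrow> \<theta> n x = 1) \<and>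
      (\<forall>x. real n + 1 \<le> norm x \<longrightarrow> \<theta> n x = 0 \<and> DF (\<theta> n) x = 0)"
  proof (intro choice allI)
    fix n :: nat
    obtain \<theta> :: "'a \<Rightarrow> real" where "\<theta> \<in> C1plusB UNIV"
      "\<And>x. norm x \<le> real n \<Longrightarrow> \<theta> x = 1"
      "\<And>x. real n + 1 \<le> norm x \<Longrightarrow> \<theta> x = 0 \<and> DF \<theta> x = 0"
      using smooth_bump[OF N, of "real n"] by blast
    then show "\<exists>\<theta>. \<theta> \<in> C1plusB UNIV \<and> (\<forall>x::'a. norm x \<le> real n \<longrightarrow> \<theta> x = 1) \<and>
        (\<forall>x. real n + 1 \<le> norm x \<longrightarrow> \<theta> x = 0 \<and> DF \<theta> x = 0)"
      by blast
  qed
  then obtain \<theta> :: "nat \<Rightarrow> 'a \<Rightarrow> real" where \<theta>: "\<And>n. \<theta> n \<in> C1plusB UNIV"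
    "\<And>n x. norm x \<le> real n \<Longrightarrow> \<theta> n x = 1"
    "\<And>n x. real n + 1 \<le> norm x \<Longrightarrow> \<theta> n x = 0 \<and> DF (\<theta> n) x = 0"
    by auto
  define H where "H = rec_nat (F 1) (\<lambda>n h x. F (n + 2) x + \<theta> n x * (h x - F (n + 2) x))"
  have H_0: "H 0 = F 1"
    by (simp add: H_def)
  have H_Suc: "H (Suc n) = (\<lambda>x. F (n + 2) x + \<theta> n x * (H n x - F (n + 2) x))" for n
    by (simp add: H_def)
  have H: "H n \<in> C1plusB UNIV" for n
    by (induction n) (simp_all only: H_0 H_Suc F \<theta> C1plusB_blend)
  have H_value: "H n x = v" if "norm x \<le> real n + 1" "\<And>m. norm x \<le> real m \<Longrightarrow> F m x = v" for n x v
    using that(1)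
  proof (induction n)
    case 0
    then show ?case
      by (simp add: H_0 that(2))
  next
    case (Suc n)
    then have "F (n + 2) x = v"
      by (intro that(2)) simp
    moreover have "H n x = v" if "norm x < real n + 1"
      using Suc.IH that by simp
    ultimately show ?case
      using \<theta>(3)[of n x] by (cases "norm x < real n + 1") (auto simp: H_Suc)
  qed
  have H_DF: "DF (H n) x = g"
    if "norm x \<le> real n + 1" "\<And>m. norm x \<le> real m \<Longrightarrow> F m x = v \<and> DF (F m) x = g" for n x v g
    using that(1)
  proof (induction n)
    case 0
    then show ?case
      by (simp add: H_0 that(2))
  next
    case (Suc n)
    then have F_x: "F (n + 2) x = v \<and> DF (F (n + 2)) x = g"
      by (intro that(2)) simp
    have "H n x = v \<and> DF (H n) x = g" if "norm x < real n + 1"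
      using Suc.IH that H_value[of x n v] \<open>\<And>m. norm x \<le> real m \<Longrightarrow> F m x = v \<and> DF (F m) x = g\<close> by simp
    moreover have "DF (H (Suc n)) x = DF (F (n + 2)) x +
        (\<theta> n x *\<^sub>R (DF (H n) x - DF (F (n + 2)) x) + (H n x - F (n + 2) x) *\<^sub>R DF (\<theta> n) x)"
      unfolding H_Suc by (rule C1plusB_blend(2)[OF H F \<theta>(1)])
    ultimately show ?case
      using F_x \<theta>(3)[of n x] by (cases "norm x < real n + 1") auto
  qed
  have H_stable: "H m x = H n x" if "n \<le> m" "norm x \<le> real n" for m n x
    using that(1)
  proof (induction m rule: dec_induct)
    case (step m)
    then show ?case
      using that(2) \<theta>(2)[of x m] by (simp add: H_Suc)
  qed simp
  \<comment> \<open>The sequence is stationary at \<open>x\<close> from the index \<open>\<lceil>|x|\<rceil>\<close> on.\<close>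
  define L where "L x = H (nat \<lceil>norm x\<rceil>) x" for x
  have L: "L x = H n x" if "norm x < real n" for n x
    unfolding L_def using that by (intro H_stable[symmetric]) linarith+
  show thesis
  proof (rule that[of L])
    show "L \<in> C1plusB UNIV"
      by (rule C1plusB_of_locally_eq(1)[OF H L])
    show "\<forall>x v. (\<forall>n. norm x \<le> real n \<longrightarrow> F n x = v) \<longrightarrow> L x = v"
    proof (intro allI impI)
      fix x :: 'a and v
      assume *: "\<forall>n. norm x \<le> real n \<longrightarrow> F n x = v"
      obtain n where "norm x < real n"
        using reals_Archimedean2 by blast
      then show "L x = v"
        using H_value[of x n v] * L by simp
    qed
    show "\<forall>x v g. (\<forall>n. norm x \<le> real n \<longrightarrow> F n x = v \<and> DF (F n) x = g) \<longrightarrow> DF L x = g"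
    proof (intro allI impI)
      fix x :: 'a and v g
      assume *: "\<forall>n. norm x \<le> real n \<longrightarrow> F n x = v \<and> DF (F n) x = g"
      obtain n where n: "norm x < real n"
        using reals_Archimedean2 by blast
      then show "DF L x = g"
        using H_DF[of x n v g] * C1plusB_of_locally_eq(2)[OF H L n] by simp
    qed
  qed
qed

section \<open>Characterisation of the extendable functions\<close>

theorem theorem61:
  fixes E :: "'a::banach set" and f :: "'a \<Rightarrow> real"
  assumes "super_reflexive TYPE('a)"
  shows "((\<exists>F \<in> C1plusB UNIV. \<forall>x\<in>E. F x = f x) \<longleftrightarrow> cond_W_tilde f E) \<and>
    (cond_W_tilde f E \<longleftrightarrow>
       (\<forall>A. A \<subseteq> E \<and> bounded A \<longrightarrow>
          bounded (f ` A) \<and>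
          (\<exists>G\<^sub>A :: 'a \<Rightarrow> ('a \<Rightarrow>\<^sub>L real). bounded (G\<^sub>A ` A) \<and> cond_W f A G\<^sub>A))) \<and>
    (\<forall>G. cond_W_tilde_with f E G \<longrightarrow>
       (\<exists>F \<in> C1plusB UNIV. (\<forall>x\<in>E. F x = f x) \<and> (\<forall>x\<in>E. DF F x = G x)))"
proof -
  obtain N :: "'a \<Rightarrow> real" where N: "equivalent_norm N" "uniformly_smooth N"
    using assms by (auto simp: super_reflexive_def)
  define pieces where "pieces n = E \<inter> cball 0 (real n)" for n
  have pieces: "pieces n \<subseteq> E" "bounded (pieces n)" for n
    by (auto simp: pieces_def intro: bounded_Int)
  have mem_pieces: "x \<in> pieces n" if "x \<in> E" "norm x \<le> real n" for x n
    using that by (simp add: pieces_def)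
  \<comment> \<open>The jets \<open>H n\<close> on the pieces need not be compatible. Only if they are restrictions
    of one \<open>G\<close> is the derivative of the glued function known on \<open>E\<close>.\<close>
  have glue: "\<exists>F\<in>C1plusB UNIV. (\<forall>x\<in>E. F x = f x) \<and>
      (\<forall>G. (\<forall>n. \<forall>x\<in>pieces n. H n x = G x) \<longrightarrow> (\<forall>x\<in>E. DF F x = G x))"
    if H: "\<And>n. bounded (f ` pieces n) \<and> bounded (H n ` pieces n) \<and> cond_W f (pieces n) (H n)"
    for H :: "nat \<Rightarrow> 'a \<Rightarrow> ('a \<Rightarrow>\<^sub>L real)"
  proof -
    have "\<exists>F. \<forall>n. F n \<in> C1plusB UNIV \<and> (\<forall>x\<in>pieces n. F n x = f x \<and> DF (F n) x = H n x)"
    proof (intro choice allI)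
      fix n
      obtain F where "F \<in> C1plusB UNIV" "\<And>x. x \<in> pieces n \<Longrightarrow> F x = f x"
        "\<And>x. x \<in> pieces n \<Longrightarrow> DF F x = H n x"
        using whitney_extension_bounded_jet[OF N, of f "pieces n" "H n"] H[of n] by blast
      then show "\<exists>F. F \<in> C1plusB UNIV \<and> (\<forall>x\<in>pieces n. F x = f x \<and> DF F x = H n x)"
        by blast
    qed
    then obtain F where F: "\<And>n. F n \<in> C1plusB UNIV"
      "\<And>n x. x \<in> pieces n \<Longrightarrow> F n x = f x \<and> DF (F n) x = H n x"
      by auto
    obtain L where "L \<in> C1plusB UNIV"
      and L_value: "\<forall>x v. (\<forall>n. norm x \<le> real n \<longrightarrow> F n x = v) \<longrightarrow> L x = v"
      and L_DF: "\<forall>x v g. (\<forall>n. norm x \<le> real n \<longrightarrow> F n x = v \<and> DF (F n) x = g) \<longrightarrow> DF L x = g"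
      by (rule C1plusB_glue[OF N F(1)])
    have "L x = f x" if "x \<in> E" for x
      using L_value F(2) mem_pieces that by simp
    moreover have "DF L x = G x" if "\<forall>n. \<forall>x\<in>pieces n. H n x = G x" "x \<in> E" for G x
    proof -
      have "\<forall>n. norm x \<le> real n \<longrightarrow> F n x = f x \<and> DF (F n) x = G x"
        using that F(2) mem_pieces by simp
      with L_DF show ?thesis
        by blast
    qed
    ultimately show ?thesis
      using \<open>L \<in> C1plusB UNIV\<close> by blast
  qed
  define iii where "iii \<longleftrightarrow> (\<forall>A. A \<subseteq> E \<and> bounded A \<longrightarrow> bounded (f ` A) \<and>
    (\<exists>G\<^sub>A :: 'a \<Rightarrow> ('a \<Rightarrow>\<^sub>L real). bounded (G\<^sub>A ` A) \<and> cond_W f A G\<^sub>A))"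
  have jet: "bounded (f ` A) \<and> bounded (G ` A) \<and> cond_W f A G"
    if "cond_W_tilde_with f E G" "A \<subseteq> E" "bounded A" for A G
    using that by (auto simp: cond_W_tilde_with_def cond_W_def)
  have i_ii: "cond_W_tilde f E" if "\<exists>F \<in> C1plusB UNIV. \<forall>x\<in>E. F x = f x"
    using that C1plusB_cond_W_tilde unfolding cond_W_tilde_def by blast
  have ii_iii: "iii" if "cond_W_tilde f E"
    using that jet unfolding cond_W_tilde_def iii_def by meson
  have iii_i: "\<exists>F \<in> C1plusB UNIV. \<forall>x\<in>E. F x = f x" if "iii"
  proof -
    have "\<exists>G :: 'a \<Rightarrow> ('a \<Rightarrow>\<^sub>L real).
        bounded (f ` pieces n) \<and> bounded (G ` pieces n) \<and> cond_W f (pieces n) G" for n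
      using \<open>iii\<close> pieces[of n] unfolding iii_def by blast
    then obtain H :: "nat \<Rightarrow> 'a \<Rightarrow> ('a \<Rightarrow>\<^sub>L real)" where
      "\<And>n. bounded (f ` pieces n) \<and> bounded (H n ` pieces n) \<and> cond_W f (pieces n) (H n)"
      by metis
    from glue[OF this] show ?thesis
      by blast
  qed
  have moreover_part: "\<exists>F \<in> C1plusB UNIV. (\<forall>x\<in>E. F x = f x) \<and> (\<forall>x\<in>E. DF F x = G x)"
    if "cond_W_tilde_with f E G" for G
    using glue[of "\<lambda>n. G", OF jet[OF that pieces]] by blast
  show ?thesis
    unfolding iii_def[symmetric] using i_ii ii_iii iii_i moreover_part by blast
qed

end
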